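(* Let $d\ge 2$, $\beta>0$ and $0<c<c_0$. Then as $n\to\infty$, $$W_n(r_n(c,\beta)) \xrightarrow{d} Po(\beta),$$ and $$\mathsf{P}\left(M_n\le r_n(c,\beta)\right)\to e^{-\beta},$$ where $Po(\beta)$ denotes a Poisson random variable with mean $\beta$ and $\xrightarrow{d}$ denotes convergence in distribution.
   Context: Let $U=[0,1]^d$ with the toroidal metric $d(x,y):=\inf\{|x-y+z| : z\in\mathbb{Z}^d\}$, where $|\cdot|$ is the Euclidean norm. For each $n$, let $\mathcal{P}^{(1)}_n$ and $\mathcal{P}^{(2)}_{cn}$ be independent homogeneous Poisson point processes on $U$ of intensities $n$ and $cn$. The $AB$ random geometric graph $G_n(cn,r)$ has vertex set $\mathcal{P}^{(1)}_n$ and an edge between distinct $X_i,X_j\in\mathcal{P}^{(1)}_n$ whenever there is some $Y\in\mathcal{P}^{(2)}_{cn}$ with $d(X_i,Y)\le r$ and $d(X_j,Y)\le r$. $W_n(r)$ is the number of isolated (degree zero) vertices of $G_n(cn,r)$, and $M_n:=\sup\{r\ge 0: W_n(r)>0\}$ is the largest nearest neighbour radius. With $\theta_d$ the volume of the unit ball in $\mathbb{R}^d$, define (for $n$ large) $r_n(c,\beta):=\left(\frac{\log(n/\beta)}{cn\theta_d}\right)^{1/d}$. For $s>0$ let $\eta(s):=\|B_O(1)\cap B_{s^{1/d}e_1}(1)\|/\theta_d$, where $\|\cdot\|$ is Lebesgue measure on $\mathbb{R}^d$, $B_x(\rho)$ is the closed Euclidean ball of radius $\rho$ about $x$, $O$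 the origin and $e_1=(1,0,\ldots,0)$. Define $c_0:=\sup\{c>0:\eta(c)+\frac1c>1\}$ if $d=2$, and $c_0:=1$ if $d\ge3$. *)

theory Defs
  imports "HOL-Probability.Probability"
begin

definition torus :: "(real ^ 'n) set" where
  "torus = {x. \<forall>i. 0 \<le> x $ i \<and> x $ i \<le> 1}"

definition torus_dist :: "real ^ 'n \<Rightarrow> real ^ 'n \<Rightarrow> real" where
  "torus_dist x y = Inf {norm (x - y + z) |z. \<forall>i. z $ i \<in> \<int>}"


section \<open>Poisson point processes\<close>

text \<open>A point process on the torus is a random finite subset of it: no multiplicities are needed,
  since a homogeneous Poisson process is almost surely simple.  Configurations carry
  the \<open>\<sigma>\<close>-algebra generated by the counting maps of Borel sets.\<close>

definition config_space :: "(real ^ 'n) set measure" where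
  "config_space =
     sigma {S. finite S \<and> S \<subseteq> torus}
       {{S. finite S \<and> S \<subseteq> torus \<and> card (S \<inter> A) = k} |A k. A \<in> sets borel}"

text \<open>The Poisson probabilities are written out because \<open>poisson_pmf\<close> is only specified for
  positive rates, whereas \<open>A\<close> may be a null set.\<close>

definition poisson_process ::
  "'w measure \<Rightarrow> real \<Rightarrow> ('w \<Rightarrow> (real ^ 'n) set) \<Rightarrow> bool" where
  "poisson_process M lam P \<longleftrightarrow>
     P \<in> measurable M config_space \<and>
     (\<forall>A k. A \<in> sets borel \<and> A \<subseteq> torus \<longrightarrow>
        measure M {\<omega> \<in> space M. card (P \<omega> \<inter> A) = k}
          = (lam * measure lborel A) ^ k / fact k * exp (- (lam * measure lborel A))) \<and>
     (\<forall>(A :: nat \<Rightarrow> (real ^ 'n) set) m.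
        (\<forall>i<m. A i \<in> sets borel \<and> A i \<subseteq> torus) \<and> disjoint_family_on A {..<m} \<longrightarrow>
        prob_space.indep_vars M (\<lambda>_. count_space UNIV) (\<lambda>i \<omega>. card (P \<omega> \<inter> A i)) {..<m})"


section \<open>The \<open>AB\<close> random geometric graph\<close>

text \<open>The graph with vertex set \<open>X\<close> is given by its set of edges, each a two-element set.\<close>

definition ab_edges :: "(real ^ 'n) set \<Rightarrow> (real ^ 'n) set \<Rightarrow> real \<Rightarrow> (real ^ 'n) set set" where
  "ab_edges X Y r =
     {{x, x'} |x x'. x \<in> X \<and> x' \<in> X \<and> x \<noteq> x' \<and>
        (\<exists>y\<in>Y. torus_dist x y \<le> r \<and> torus_dist x' y \<le> r)}"

definition ab_degree ::
  "(real ^ 'n) set \<Rightarrow> (real ^ 'n) set \<Rightarrow> real \<Rightarrow> real ^ 'n \<Rightarrow> nat" where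
  "ab_degree X Y r x = card {e \<in> ab_edges X Y r. x \<in> e}"

definition num_isolated :: "(real ^ 'n) set \<Rightarrow> (real ^ 'n) set \<Rightarrow> real \<Rightarrow> nat" where
  "num_isolated X Y r = card {x \<in> X. ab_degree X Y r x = 0}"

text \<open>The supremum is taken in \<open>[0, \<infinity>]\<close>: it is \<open>\<infinity>\<close> if there is, for example, a single vertex,
  and \<open>0\<close> if there is no vertex at all.\<close>

definition largest_nn_radius :: "(real ^ 'n) set \<Rightarrow> (real ^ 'n) set \<Rightarrow> ennreal" where
  "largest_nn_radius X Y = Sup {ennreal r |r. r \<ge> 0 \<and> num_isolated X Y r > 0}"


section \<open>The constants\<close>

definition theta :: "'n::finite itself \<Rightarrow> real" where
  "theta _ = measure lborel (cball (0 :: real ^ 'n) 1)"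

definition conn_radius :: "'n::finite itself \<Rightarrow> real \<Rightarrow> real \<Rightarrow> nat \<Rightarrow> real" where
  "conn_radius T c \<beta> n =
     (ln (real n / \<beta>) / (c * real n * theta T)) powr (1 / real CARD('n))"

text \<open>The index type has no distinguished first element; the coordinate direction chosen is
  irrelevant by symmetry.\<close>

definition e1 :: "real ^ 'n" where
  "e1 = axis (SOME i. True) 1"

definition eta :: "'n::finite itself \<Rightarrow> real \<Rightarrow> real" where
  "eta T s =
     measure lborel (cball (0 :: real ^ 'n) 1 \<inter> cball ((s powr (1 / real CARD('n))) *\<^sub>R e1) 1)
       / theta T"

definition c0 :: "'n::finite itself \<Rightarrow> real" where
  "c0 T = (if CARD('n) = 2 then Sup {c. c > 0 \<and> eta T c + 1 / c > 1} else 1)"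

end

theory Submission
  imports Defs "HOL-Real_Asymp.Real_Asymp"
begin

text \<open>A vertex without any point of the second process within distance \<open>r\<^sub>n\<close> is isolated.  Given the
  second process, the number of these vertices is Poisson with mean \<open>n V\<close>, where \<open>V\<close> is the volume
  not covered by the balls of radius \<open>r\<^sub>n\<close> about the second process.  The expectation of \<open>n V\<close> is
  exactly \<open>\<beta>\<close>, and its variance tends to 0 since the volume of a ball outside a translate of it by
  \<open>h\<close> grows at least linearly in \<open>norm h\<close>.

  All other isolated vertices \<open>x\<close> have a point \<open>y\<close> of the second process nearby.  As \<open>c < c0\<close>, there is
  \<open>q > c\<close> with \<open>eta q + 1 / c > 1\<close>.  Up to arbitrarily small losses, having no other vertex within
  \<open>q powr (1 / d) r\<^sub>n\<close> of \<open>x\<close> has probability \<open>n powr (- q / c)\<close>; if there is such a vertex, then the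
  emptiness of the ball about \<open>y\<close> and of the lens between the two vertices costs
  \<open>n powr (- 1 / c - eta q)\<close>.  A union bound over a grid of \<open>O(n)\<close> possible positions of \<open>x\<close>, and
  boundedly many relative positions of the other two points, shows that with probability
  tending to 1 no such vertex exists.\<close>

section \<open>Geometry of the torus\<close>

text \<open>Up to constants, an empty region of volume \<open>v * theta * r ^ d\<close> costs
  \<open>n powr (- v / c)\<close> for the first process and \<open>n powr (- v)\<close> for the
  second, because \<open>theta * r ^ d = ln (n / \<beta>) / (c * n)\<close>. Hence the two
  exponents: \<open>q / c\<close> for a ball of relative volume \<open>q\<close>, and
  \<open>1 / c + eta q\<close> for a unit ball together with a lens. Below \<open>c0\<close> both
  can be made larger than 1, while there are only about \<open>n / ln n\<close> positions. The
  margin is a power of \<open>n\<close>, so rounding positions may cost constant factors and a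
  little in the exponents; this is why a union bound can replace Palm calculus.

  The obstacle is the dependence between isolated vertices. Counting only those far from the second
  process removes it: their number is exactly a mixed Poisson variable, so no Poisson approximation
  is required, only continuity of the Poisson weights in the mean. For the variance a linear gain in
  volume is enough, since the pairs of points too close to profit from it occupy little
  volume.\<close>

definition int_lattice :: "(real ^ 'n) set" where
  "int_lattice = {z. \<forall>i. z $ i \<in> \<int>}"

lemma closed_int_lattice: "closed (int_lattice :: (real ^ 'n) set)"
proof -
  have *: "int_lattice = (\<Inter>i. (\<lambda>z. z $ i) -` \<int> :: (real ^ 'n) set)"
    by (auto simp: int_lattice_def)
  have "closed ((\<lambda>z :: real ^ 'n. z $ i) -` \<int>)" for i
    by (intro closed_vimage closed_Ints continuous_intros)
  then show ?thesis by (subst *) (intro closed_INT ballI)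
qed

lemma zero_in_int_lattice [simp]: "0 \<in> int_lattice"
  and int_lattice_add: "z \<in> int_lattice \<Longrightarrow> w \<in> int_lattice \<Longrightarrow> z + w \<in> int_lattice"
  and int_lattice_diff: "z \<in> int_lattice \<Longrightarrow> w \<in> int_lattice \<Longrightarrow> z - w \<in> int_lattice"
  and int_lattice_minus: "z \<in> int_lattice \<Longrightarrow> - z \<in> int_lattice"
  by (auto simp: int_lattice_def)

text \<open>As a distance to a closed set, the infimum is attained, continuous and
  nonnegative.\<close>

lemma torus_dist_eq_infdist:
  fixes x y :: "real ^ 'n"
  shows "torus_dist x y = infdist (y - x) int_lattice"
proof -
  have "{norm (x - y + z) |z. \<forall>i. z $ i \<in> \<int>} = (dist (y - x)) ` int_lattice"
  proof -
    have "norm (x - y + z) = dist (y - x) z" for z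
      by (simp add: dist_norm norm_minus_commute[of y] algebra_simps)
    then show ?thesis by (auto simp: int_lattice_def)
  qed
  moreover have "int_lattice \<noteq> ({} :: (real ^ 'n) set)" using zero_in_int_lattice by blast
  ultimately show ?thesis
    by (simp add: torus_dist_def infdist_def)
qed

lemma torus_dist_le_iff: "torus_dist x y \<le> r \<longleftrightarrow> (\<exists>z\<in>int_lattice. norm (x - y + z) \<le> r)"
proof
  assume r: "torus_dist x y \<le> r"
  have "int_lattice \<noteq> ({} :: (real ^ 'n) set)" using zero_in_int_lattice by blast
  from infdist_attains_inf[OF closed_int_lattice this, of "y - x"]
  obtain z where "z \<in> int_lattice" "infdist (y - x) int_lattice = dist (y - x) z" by blast
  with r show "\<exists>z\<in>int_lattice. norm (x - y + z) \<le> r"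
    by (intro bexI[of _ z]) (auto simp: torus_dist_eq_infdist dist_norm algebra_simps
       norm_minus_commute[of y "x + z"])
next
  assume "\<exists>z\<in>int_lattice. norm (x - y + z) \<le> r"
  then obtain z where z: "z \<in> int_lattice" "norm (x - y + z) \<le> r" by blast
  have "infdist (y - x) int_lattice \<le> dist (y - x) z" by (rule infdist_le[OF z(1)])
  also have "\<dots> = norm (x - y + z)"
    by (simp add: dist_norm norm_minus_commute[of y "x + z"] algebra_simps)
  finally show "torus_dist x y \<le> r" using z(2) by (simp add: torus_dist_eq_infdist)
qed

lemma torus_dist_le_norm: "torus_dist x y \<le> norm (x - y)"
  unfolding torus_dist_le_iff by (rule bexI[of _ 0]) auto

lemma torus_dist_commute:
  fixes x y :: "real ^ 'n"
  shows "torus_dist x y = torus_dist y x"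
proof -
  have "torus_dist x y \<le> torus_dist y x" for x y :: "real ^ 'n"
  proof -
    obtain z where z: "z \<in> int_lattice" "norm (y - x + z) \<le> torus_dist y x"
      using torus_dist_le_iff[of y x "torus_dist y x"] by auto
    show ?thesis unfolding torus_dist_le_iff
      by (rule bexI[of _ "- z"]) (use z in \<open>auto simp: int_lattice_minus norm_minus_commute[of x "y+z"] algebra_simps\<close>)
  qed
  then show ?thesis by (simp add: antisym)
qed

lemma torus_dist_triangle: "torus_dist x y \<le> torus_dist x w + torus_dist w y"
proof -
  obtain z z' where z: "z \<in> int_lattice" "norm (x - w + z) \<le> torus_dist x w"
    "z' \<in> int_lattice" "norm (w - y + z') \<le> torus_dist w y"
    using torus_dist_le_iff[of x w "torus_dist x w"] torus_dist_le_iff[of w y "torus_dist w y"] by auto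
  have "norm (x - y + (z + z')) \<le> norm (x - w + z) + norm (w - y + z')"
    by (rule order_trans[OF _ norm_triangle_ineq]) (simp add: algebra_simps)
  then show ?thesis unfolding torus_dist_le_iff
    using z by (intro bexI[of _ "z + z'"]) (auto intro: int_lattice_add)
qed

lemma continuous_torus_dist [continuous_intros]:
  assumes "continuous_on S f" "continuous_on S g"
  shows "continuous_on S (\<lambda>x. torus_dist (f x) (g x))"
  unfolding torus_dist_eq_infdist by (intro continuous_intros assms)

lemma borel_measurable_torus_dist [measurable]:
  assumes "f \<in> borel_measurable M" "g \<in> borel_measurable M"
  shows "(\<lambda>x. torus_dist (f x) (g x)) \<in> borel_measurable M"
proof -
  have "(\<lambda>(x :: real ^ 'n, y). torus_dist x y) \<in> borel_measurable borel"
    by (intro borel_measurable_continuous_onI) (auto simp: case_prod_beta intro!: continuous_intros)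
  from measurable_compose[OF borel_measurable_Pair[OF assms] this] show ?thesis by simp
qed

text \<open>Represents the image of \<open>A\<close> in the quotient by the lattice. Opposite faces
  of the closed cube stand for the same points of the quotient, so boundary points may occur several
  times; they form a null set.\<close>

definition torus_lift :: "(real ^ 'n) set \<Rightarrow> (real ^ 'n) set" where
  "torus_lift A = {u \<in> torus. \<exists>z\<in>int_lattice. u + z \<in> A}"

definition torus_ball :: "real ^ 'n \<Rightarrow> real \<Rightarrow> (real ^ 'n) set" where
  "torus_ball x r = {u \<in> torus. torus_dist u x \<le> r}"

lemma torus_ball_eq_lift: "torus_ball x r = torus_lift (cball x r)"
  by (auto simp: torus_ball_def torus_lift_def torus_dist_le_iff dist_norm norm_minus_commute
     algebra_simps)

lemma torus_eq_cbox: "torus = cbox (0 :: real ^ 'n) 1"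
  by (auto simp: torus_def mem_box_cart)

lemma torus_borel [measurable]: "torus \<in> sets borel"
  by (simp add: torus_eq_cbox)

lemma torus_ball_borel [measurable]: "torus_ball x r \<in> sets borel"
  unfolding torus_ball_def by measurable

lemma torus_ball_subset: "torus_ball x r \<subseteq> torus"
  by (auto simp: torus_ball_def)

lemma measure_torus: "measure lborel (torus :: (real ^ 'n) set) = 1"
proof -
  have "\<And>b :: real ^ 'n. b \<in> Basis \<Longrightarrow> 1 \<bullet> b = 1"
    by (auto simp: Basis_vec_def inner_axis)
  then show ?thesis by (simp add: torus_eq_cbox measure_lborel_cbox_eq)
qed

lemma emeasure_torus: "emeasure lborel (torus :: (real ^ 'n) set) = 1"
  using measure_torus[where 'n = 'n] emeasure_bounded_finite[of "torus :: (real ^ 'n) set"] bounded_cbox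
  by (simp add: torus_eq_cbox emeasure_eq_ennreal_measure less_top)

lemma countable_int_lattice: "countable (int_lattice :: (real ^ 'n) set)"
proof -
  have *: "int_lattice = (\<lambda>f :: 'n \<Rightarrow> int. \<chi> i. real_of_int (f i)) ` UNIV"
  proof (intro equalityI subsetI)
    fix z :: "real ^ 'n" assume "z \<in> int_lattice"
    then have "z = (\<chi> i. real_of_int \<lfloor>z $ i\<rfloor>)"
      by (auto simp: int_lattice_def vec_eq_iff elim!: Ints_cases)
    then show "z \<in> range (\<lambda>f :: 'n \<Rightarrow> int. \<chi> i. real_of_int (f i))" by (metis rangeI)
  qed (auto simp: int_lattice_def)
  show ?thesis by (subst *) (intro countable_image countableI_type)
qed

text \<open>Dropping one of each pair of opposite faces gives an exact fundamental domain: every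
  point has a unique lattice translate in it.\<close>

definition tile :: "(real ^ 'n) set" where
  "tile = {x. \<forall>i. 0 \<le> x $ i \<and> x $ i < 1}"

lemma tile_borel [measurable]: "tile \<in> sets borel"
  unfolding tile_def by measurable

lemma emeasure_torus_Int_eq_tile:
  assumes [measurable]: "A \<in> sets borel"
  shows "emeasure lborel (torus \<inter> A) = emeasure lborel (tile \<inter> A)"
proof (rule emeasure_eq_AE)
  have "negligible {x :: real ^ 'n. x $ i = 1}" for i
    using negligible_standard_hyperplane[of "axis i 1 :: real ^ 'n" 1]
    by (simp add: cart_eq_inner_axis)
  then have "negligible (\<Union>i. {x :: real ^ 'n. x $ i = 1})"
    by (intro negligible_Union) auto
  then have "AE x in lebesgue. x \<notin> (\<Union>i. {x :: real ^ 'n. x $ i = 1})"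
    by (intro AE_not_in) (simp add: negligible_iff_null_sets)
  then have "AE x in lborel. x \<notin> (\<Union>i. {x :: real ^ 'n. x $ i = 1})"
    by (subst AE_completion_iff[symmetric])
  then show "AE x in lborel. (x \<in> torus \<inter> A) = (x \<in> tile \<inter> A)"
    by eventually_elim (auto simp: torus_def tile_def order.order_iff_strict)
qed auto

lemma tile_translate_ex1: "\<exists>!z. z \<in> int_lattice \<and> x - z \<in> tile"
proof (rule ex1I)
  let ?z = "(\<chi> i. real_of_int \<lfloor>x $ i\<rfloor>)"
  show "?z \<in> int_lattice \<and> x - ?z \<in> tile"
    by (auto simp: int_lattice_def tile_def) linarith
  fix z assume z: "z \<in> int_lattice \<and> x - z \<in> tile"
  have "z $ i = real_of_int \<lfloor>x $ i\<rfloor>" for i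
  proof -
    from z obtain k where k: "z $ i = of_int k" by (auto simp: int_lattice_def elim: Ints_cases)
    from z have "0 \<le> x $ i - of_int k" "x $ i - of_int k < 1" by (auto simp: tile_def simp flip: k)
    then have "\<lfloor>x $ i\<rfloor> = k" by linarith
    with k show ?thesis by simp
  qed
  then show "z = ?z" by (simp add: vec_eq_iff)
qed

text \<open>Cut \<open>A\<close> along the lattice cells and move every piece back into
  \<open>tile\<close>; translation invariance and countability of the lattice do the rest.\<close>

lemma emeasure_eq_sum_tile:
  fixes A :: "(real ^ 'n) set"
  assumes [measurable]: "A \<in> sets borel"
  shows "emeasure lborel A = (\<integral>\<^sup>+ z. emeasure lborel (tile \<inter> {u. u + z \<in> A}) \<partial>count_space int_lattice)"
proof -
  have "A = (\<Union>z\<in>int_lattice. {x \<in> A. x - z \<in> tile})"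
    using tile_translate_ex1 by blast
  then have "emeasure lborel A = emeasure lborel (\<Union>z\<in>int_lattice. {x \<in> A. x - z \<in> tile})" by simp
  also have "\<dots> = (\<integral>\<^sup>+ z. emeasure lborel {x \<in> A. x - z \<in> tile} \<partial>count_space int_lattice)"
  proof (rule emeasure_UN_countable[OF _ countable_int_lattice])
    show "disjoint_family_on (\<lambda>z. {x \<in> A. x - z \<in> tile}) int_lattice"
      using tile_translate_ex1 by (fastforce simp: disjoint_family_on_def)
  qed measurable
  also have "\<dots> = (\<integral>\<^sup>+ z. emeasure lborel (tile \<inter> {u. u + z \<in> A}) \<partial>count_space int_lattice)"
  proof (rule nn_integral_cong)
    fix z :: "real ^ 'n"
    have "emeasure lborel {x \<in> A. x - z \<in> tile} = emeasure (distr lborel borel ((+) z)) {x \<in> A. x - z \<in> tile}"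
      by (simp add: lborel_distr_plus)
    also have "\<dots> = emeasure lborel ((+) z -` {x \<in> A. x - z \<in> tile} \<inter> space lborel)"
      by (intro emeasure_distr) measurable
    also have "(+) z -` {x \<in> A. x - z \<in> tile} \<inter> space lborel = tile \<inter> {u. u + z \<in> A}"
      by (auto simp: add.commute)
    finally show "emeasure lborel {x \<in> A. x - z \<in> tile} = emeasure lborel (tile \<inter> {u. u + z \<in> A})" .
  qed
  finally show ?thesis .
qed

lemma int_lattice_norm_ge_1:
  assumes "z \<in> int_lattice" "z \<noteq> 0"
  shows "norm z \<ge> 1"
proof -
  from assms(2) obtain i where i: "z $ i \<noteq> 0" by (auto simp: vec_eq_iff)
  from assms(1) obtain k where k: "z $ i = of_int k" by (auto simp: int_lattice_def elim: Ints_cases)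
  with i have "1 \<le> \<bar>z $ i\<bar>" by (simp add: k)
  also have "\<dots> \<le> norm z" by (rule component_le_norm_cart)
  finally show ?thesis .
qed

lemma torus_lift_eq_UN: "torus_lift A = torus \<inter> (\<Union>z\<in>int_lattice. {u. u + z \<in> A})"
  by (auto simp: torus_lift_def)

lemma torus_lift_borel [measurable]:
  assumes [measurable]: "A \<in> sets borel"
  shows "torus_lift A \<in> sets borel"
  unfolding torus_lift_eq_UN
  by (intro sets.Int torus_borel sets.countable_UN'' countable_int_lattice) (measurable)

text \<open>A set of diameter less than 1 has disjoint lattice translates.\<close>

lemma measure_torus_lift:
  fixes A :: "(real ^ 'n) set"
  assumes [measurable]: "A \<in> sets borel" and diam: "\<And>x y. x \<in> A \<Longrightarrow> y \<in> A \<Longrightarrow> dist x y < 1"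
  shows "measure lborel (torus_lift A) = measure lborel A"
proof -
  let ?T = "\<lambda>z. {u. u + z \<in> A}"
  have "emeasure lborel (torus_lift A) = emeasure lborel (tile \<inter> (\<Union>z\<in>int_lattice. ?T z))"
    unfolding torus_lift_eq_UN
    by (intro emeasure_torus_Int_eq_tile sets.countable_UN'' countable_int_lattice) measurable
  also have "tile \<inter> (\<Union>z\<in>int_lattice. ?T z) = (\<Union>z\<in>int_lattice. tile \<inter> ?T z)" by auto
  also have "emeasure lborel \<dots> = (\<integral>\<^sup>+ z. emeasure lborel (tile \<inter> ?T z) \<partial>count_space int_lattice)"
  proof (rule emeasure_UN_countable[OF _ countable_int_lattice])
    have "z = w" if "z \<in> int_lattice" "w \<in> int_lattice" "u + z \<in> A" "u + w \<in> A" for z w u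
    proof (rule ccontr)
      assume "z \<noteq> w"
      then have "norm (z - w) \<ge> 1" using that by (intro int_lattice_norm_ge_1 int_lattice_diff) auto
      moreover have "norm (z - w) < 1" using diam[OF that(3,4)] by (simp add: dist_norm)
      ultimately show False by simp
    qed
    then show "disjoint_family_on (\<lambda>z. tile \<inter> ?T z) int_lattice"
      unfolding disjoint_family_on_def by blast
  qed measurable
  also have "\<dots> = emeasure lborel A" by (rule emeasure_eq_sum_tile[symmetric]) simp
  finally show ?thesis by (simp add: measure_def)
qed

section \<open>Volumes of balls, Euclidean and on the torus\<close>

lemma measure_lborel_cball:
  fixes x :: "real ^ 'n"
  assumes "r \<ge> 0"
  shows "measure lborel (cball x r) = theta TYPE('n) * r ^ CARD('n)"
  using content_cball[of r x] content_cball[of 1 "0 :: real ^ 'n"] assms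
  by (simp add: theta_def)

lemma theta_pos: "theta TYPE('n::finite) > 0"
  using content_cball[of 1 "0 :: real ^ 'n"] by (simp add: theta_def)

lemma measure_torus_lift_subset_cball:
  fixes x :: "real ^ 'n"
  assumes "S \<in> sets borel" "S \<subseteq> cball x r" "r < 1 / 2"
  shows "measure lborel (torus_lift S) = measure lborel S"
proof (rule measure_torus_lift[OF assms(1)])
  fix u v assume "u \<in> S" "v \<in> S"
  then have "dist x u \<le> r" "dist x v \<le> r" using assms(2) by auto
  then show "dist u v < 1" using assms(3) dist_triangle2[of u v x] dist_commute[of u x] dist_commute[of v x] by linarith
qed

lemma measure_torus_ball:
  fixes x :: "real ^ 'n"
  assumes "0 \<le> r" "r < 1 / 2"
  shows "measure lborel (torus_ball x r) = theta TYPE('n) * r ^ CARD('n)"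
  unfolding torus_ball_eq_lift
  using measure_torus_lift_subset_cball[of "cball x r" x r] assms by (simp add: measure_lborel_cball)

lemma fmeasurable_lborel_bounded:
  fixes S :: "'a::euclidean_space set"
  assumes "S \<in> sets borel" "bounded S"
  shows "S \<in> fmeasurable lborel"
  using assms emeasure_bounded_finite[of S] by (intro fmeasurableI) auto

lemma measure_lborel_translation:
  fixes S :: "'a::euclidean_space set"
  assumes [measurable]: "S \<in> sets borel"
  shows "measure lborel ((+) a ` S) = measure lborel S"
proof -
  have eq: "(+) a ` S = (\<lambda>x. x - a) -` S"
    by (auto simp: image_iff) (metis add.commute diff_add_cancel)
  have "(\<lambda>x. x - a) -` S \<in> sets borel"
    by (rule measurable_sets_borel[OF _ assms]) simp
  then have [measurable]: "(+) a ` S \<in> sets borel" by (simp add: eq)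
  have "measure lborel ((+) a ` S) = measure (distr lborel borel ((+) a)) ((+) a ` S)"
    by (simp add: lborel_distr_plus)
  also have "\<dots> = measure lborel ((+) a -` ((+) a ` S) \<inter> space lborel)"
    by (intro measure_distr) measurable
  also have "(+) a -` ((+) a ` S) \<inter> space lborel = S" by auto
  finally show ?thesis .
qed

lemma fmeasurable_torus_ball: "torus_ball x r \<in> fmeasurable lborel"
  by (intro fmeasurable_lborel_bounded torus_ball_borel bounded_subset[OF _ torus_ball_subset])
    (simp add: torus_eq_cbox bounded_cbox)

text \<open>The volume of \<open>cball x r - cball (x + k h) r\<close> is at most \<open>k\<close> times that for \<open>k = 1\<close>, and
  for some \<open>k \<le> 4 r / norm h\<close> the two balls are disjoint.\<close>

lemma measure_cball_diff_ge:
  fixes x h :: "real ^ 'n"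
  assumes r: "r > 0" and h: "norm h \<le> 2 * r"
  shows "measure lborel (cball x r - cball (x + h) r) \<ge> theta TYPE('n) * r ^ CARD('n) * (norm h / (4 * r))"
proof (cases "h = 0")
  case False
  let ?f = "\<lambda>k :: nat. measure lborel (cball x r - cball (x + real k *\<^sub>R h) r)"
  have fm: "cball y r - cball z r \<in> fmeasurable lborel" for y z :: "real ^ 'n"
    by (intro fmeasurable_lborel_bounded) (auto intro: bounded_subset[OF bounded_cball])
  have *: "?f k \<le> real k * ?f 1" for k
  proof (induction k)
    case (Suc k)
    let ?y = "x + real k *\<^sub>R h"
    \<comment> \<open>A point outside the last ball either misses the one before already, or lies in
      that one and leaves it with a single further step; the latter set is a translate of the case
      \<open>k = 1\<close>.\<close>
    have "?f (Suc k) \<le> measure lborel ((cball x r - cball ?y r) \<union> (cball ?y r - cball (?y + h) r))"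
      by (intro measure_mono_fmeasurable fmeasurable.Un fm) (auto simp: algebra_simps)
    also have "\<dots> \<le> ?f k + measure lborel (cball ?y r - cball (?y + h) r)"
      by (intro measure_Un_le) auto
    also have "cball ?y r - cball (?y + h) r = (+) (real k *\<^sub>R h) ` (cball x r - cball (x + h) r)"
      using cball_translation[of "real k *\<^sub>R h" x r] cball_translation[of "real k *\<^sub>R h" "x + h" r]
      by (simp add: image_set_diff ac_simps)
    also have "measure lborel \<dots> = ?f 1"
      by (subst measure_lborel_translation) auto
    finally show ?case using Suc.IH by (simp add: algebra_simps)
  qed simp
  \<comment> \<open>The least integer above \<open>2 * r / norm h\<close>. That quotient is at least
    1, so adding 1 at most doubles it; this is the 4 in the bound.\<close>
  define k where "k = nat \<lfloor>2 * r / norm h\<rfloor> + 1"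
  have hpos: "norm h > 0" using False by simp
  have ge1: "2 * r / norm h \<ge> 1" using h hpos by simp
  have k1: "real k > 2 * r / norm h" unfolding k_def using ge1 by linarith
  have k2: "real k \<le> 4 * r / norm h" unfolding k_def using ge1 by linarith
  have kh: "real k * norm h > 2 * r" using k1 hpos by (simp add: field_simps)
  have "cball x r \<inter> cball (x + real k *\<^sub>R h) r = {}"
  proof (rule ccontr)
    assume "cball x r \<inter> cball (x + real k *\<^sub>R h) r \<noteq> {}"
    then obtain y where "dist x y \<le> r" "dist (x + real k *\<^sub>R h) y \<le> r" by auto
    then have "dist x (x + real k *\<^sub>R h) \<le> 2 * r"
      using dist_triangle2[of x "x + real k *\<^sub>R h" y] by linarith
    then show False using kh by (simp add: dist_norm)
  qed
  then have "cball x r - cball (x + real k *\<^sub>R h) r = cball x r" by blast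
  then have "theta TYPE('n) * r ^ CARD('n) \<le> real k * ?f 1"
    using *[of k] r by (simp add: measure_lborel_cball)
  also have "\<dots> \<le> (4 * r / norm h) * ?f 1"
    by (intro mult_right_mono k2) simp
  finally show ?thesis using r hpos by (simp add: field_simps)
qed simp

lemma torus_lift_translate:
  assumes "z \<in> int_lattice"
  shows "torus_lift ((+) z ` A) = torus_lift A"
proof (intro equalityI subsetI)
  fix u assume "u \<in> torus_lift ((+) z ` A)"
  then obtain w a where *: "u \<in> torus" "w \<in> int_lattice" "u + w = z + a" "a \<in> A" by (auto simp: torus_lift_def)
  then have "u + (w - z) = a" by (simp add: algebra_simps)
  with * show "u \<in> torus_lift A"
    by (auto simp: torus_lift_def intro!: bexI[of _ "w - z"] int_lattice_diff assms)
next
  fix u assume "u \<in> torus_lift A"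
  then obtain w where *: "u \<in> torus" "w \<in> int_lattice" "u + w \<in> A" by (auto simp: torus_lift_def)
  then have "u + (w + z) \<in> (+) z ` A" by (auto simp: algebra_simps)
  with * show "u \<in> torus_lift ((+) z ` A)"
    by (auto simp: torus_lift_def intro!: bexI[of _ "w + z"] int_lattice_add assms)
qed

lemma torus_lift_Un: "torus_lift (A \<union> B) = torus_lift A \<union> torus_lift B"
  by (auto simp: torus_lift_def)

text \<open>The lattice translate of \<open>x\<close> nearest to \<open>y\<close> brings both balls
  into one Euclidean ball of radius \<open>3 * r\<close>, and \<open>r < 1 / 6\<close> keeps this
  radius below \<open>1 / 2\<close>, where passing to the torus preserves volume.\<close>

lemma measure_torus_ball_Un_ge:
  fixes x y :: "real ^ 'n"
  assumes r: "0 < r" "r < 1 / 6" and y: "torus_dist x y \<le> 2 * r"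
  shows "measure lborel (torus_ball x r \<union> torus_ball y r)
    \<ge> theta TYPE('n) * r ^ CARD('n) * (1 + torus_dist x y / (4 * r))"
proof -
  obtain z where z: "z \<in> int_lattice" "norm (x - y + z) \<le> torus_dist x y"
    using torus_dist_le_iff[of x y "torus_dist x y"] by auto
  let ?x = "x + z"
  have 1: "torus_ball x r = torus_lift (cball ?x r)"
    using torus_lift_translate[OF z(1), of "cball x r"]
    by (simp only: torus_ball_eq_lift add.commute[of x] cball_translation)
  have n: "norm (?x - y) \<le> torus_dist x y" using z by (simp add: algebra_simps)
  have "torus_dist x y \<le> norm (?x - y)"
    using torus_dist_le_iff[of x y "norm (?x - y)"] z(1) by (auto simp: algebra_simps)
  with n have n: "norm (?x - y) = torus_dist x y" by simp
  have sub: "cball ?x r \<union> cball y r \<subseteq> cball ?x (3 * r)"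
  proof -
    have "dist ?x w \<le> 3 * r" if "dist y w \<le> r" for w
      using dist_triangle[of ?x w y] that n y by (simp add: dist_norm)
    then show ?thesis using r by auto
  qed
  have "measure lborel (torus_ball x r \<union> torus_ball y r) = measure lborel (cball ?x r \<union> cball y r)"
    unfolding 1 torus_ball_eq_lift[of y] torus_lift_Un[symmetric]
    by (rule measure_torus_lift_subset_cball[OF _ sub]) (use r in auto)
  also have "\<dots> = measure lborel (cball ?x r) + measure lborel (cball y r - cball ?x r)"
    by (intro measure_Un2 fmeasurable_lborel_bounded) auto
  also have "measure lborel (cball ?x r) = theta TYPE('n) * r ^ CARD('n)"
    using r by (intro measure_lborel_cball) auto
  finally show ?thesis
    using measure_cball_diff_ge[of r "?x - y" y] r y by (simp add: n algebra_simps)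
qed

section \<open>Rotations and the volume of lenses\<close>

lemma nn_integral_lborel_shift:
  fixes f :: "'a::euclidean_space \<Rightarrow> ennreal"
  assumes [measurable]: "f \<in> borel_measurable borel"
  shows "(\<integral>\<^sup>+ x. f (a + x) \<partial>lborel) = (\<integral>\<^sup>+ x. f x \<partial>lborel)"
proof -
  have "(\<integral>\<^sup>+ x. f x \<partial>lborel) = (\<integral>\<^sup>+ x. f x \<partial>distr lborel borel ((+) a))"
    by (simp add: lborel_distr_plus)
  also have "\<dots> = (\<integral>\<^sup>+ x. f (a + x) \<partial>lborel)"
    by (rule nn_integral_distr) auto
  finally show ?thesis by simp
qed

text \<open>The fact \<open>measure_orthogonal_image\<close> needs a well-ordered index type.  In general, compare the
  two iterated integrals of \<open>1\<^sub>S(f x) 1\<^sub>B(y - f x)\<close> for the unit ball \<open>B\<close>, which \<open>f\<close> preserves.\<close>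

lemma emeasure_lborel_vimage_orthogonal:
  fixes f :: "'a::euclidean_space \<Rightarrow> 'a"
  assumes f: "orthogonal_transformation f" and [measurable]: "S \<in> sets borel"
  shows "emeasure lborel (f -` S) = emeasure lborel S"
proof -
  let ?B = "cball (0 :: 'a) 1"
  have lin: "linear f" and nrm: "norm (f x) = norm x" for x
    using f by (auto simp: orthogonal_transformation)
  have [measurable]: "f \<in> borel_measurable borel"
    by (intro borel_measurable_continuous_onI linear_continuous_on) (use lin in \<open>simp add: linear_conv_bounded_linear\<close>)
  have [measurable]: "?B \<in> sets borel" by simp
  \<comment> \<open>Positive and finite, so the volume of the ball can be cancelled at the
    end.\<close>
  have B: "0 < emeasure lborel ?B" "emeasure lborel ?B < \<infinity>"
    by (auto simp: emeasure_lborel_cball_finite emeasure_cball)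
  let ?g = "\<lambda>x y. indicator S (f x) * indicator ?B (y - f x) :: ennreal"
  have "emeasure lborel (f -` S) * emeasure lborel ?B = (\<integral>\<^sup>+ x. indicator (f -` S) x * emeasure lborel ?B \<partial>lborel)"
    using measurable_sets_borel[of f borel S] by (subst nn_integral_multc) auto
  also have "\<dots> = (\<integral>\<^sup>+ x. (\<integral>\<^sup>+ y. ?g x y \<partial>lborel) \<partial>lborel)"
  proof (rule nn_integral_cong)
    fix x
    have "(\<integral>\<^sup>+ y. ?g x y \<partial>lborel) = indicator S (f x) * (\<integral>\<^sup>+ y. indicator ?B (- f x + y) \<partial>lborel)"
    proof (subst nn_integral_cmult[symmetric])
      show "(\<lambda>y. indicator ?B (- f x + y) :: ennreal) \<in> borel_measurable lborel" by measurable
    qed simp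
    also have "(\<integral>\<^sup>+ y. indicator ?B (- f x + y) \<partial>lborel) = emeasure lborel ?B"
      by (subst nn_integral_lborel_shift) auto
    finally show "indicator (f -` S) x * emeasure lborel ?B = (\<integral>\<^sup>+ y. ?g x y \<partial>lborel)"
      by (simp add: indicator_def)
  qed
  also have "\<dots> = (\<integral>\<^sup>+ y. (\<integral>\<^sup>+ x. ?g x y \<partial>lborel) \<partial>lborel)"
    by (intro lborel_pair.Fubini') measurable
  also have "\<dots> = (\<integral>\<^sup>+ y. (\<integral>\<^sup>+ x. indicator S (f x + y) * indicator ?B x \<partial>lborel) \<partial>lborel)"
  proof (rule nn_integral_cong)
    fix y
    \<comment> \<open>With \<open>y = f y'\<close>, shifting \<open>x\<close> by \<open>y'\<close>
      turns \<open>y - f x\<close> into \<open>- f x\<close>, which lies in the ball exactly if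
      \<open>x\<close> does. After the next exchange of integrals the inner one is a mere
      translation of \<open>S\<close>.\<close>
    obtain y' where y': "y = f y'" using orthogonal_transformation_surj[OF f] by (meson surjD)
    have "(\<integral>\<^sup>+ x. ?g x y \<partial>lborel) = (\<integral>\<^sup>+ x. ?g (y' + x) y \<partial>lborel)"
      by (rule nn_integral_lborel_shift[symmetric]) measurable
    also have "\<dots> = (\<integral>\<^sup>+ x. indicator S (f x + y) * indicator ?B x \<partial>lborel)"
      by (intro nn_integral_cong) (simp add: linear_add[OF lin] y' indicator_def nrm add.commute)
    finally show "(\<integral>\<^sup>+ x. ?g x y \<partial>lborel) = \<dots>" .
  qed
  also have "\<dots> = (\<integral>\<^sup>+ x. (\<integral>\<^sup>+ y. indicator S (f x + y) * indicator ?B x \<partial>lborel) \<partial>lborel)"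
    by (intro lborel_pair.Fubini') measurable
  also have "\<dots> = (\<integral>\<^sup>+ x. emeasure lborel S * indicator ?B x \<partial>lborel)"
  proof (rule nn_integral_cong)
    fix x
    have "(\<integral>\<^sup>+ y. indicator S (f x + y) * indicator ?B x \<partial>lborel) = (\<integral>\<^sup>+ y. indicator S (f x + y) \<partial>lborel) * indicator ?B x"
      by (intro nn_integral_multc) measurable
    also have "(\<integral>\<^sup>+ y. indicator S (f x + y) \<partial>lborel) = emeasure lborel S"
      by (subst nn_integral_lborel_shift) auto
    finally show "(\<integral>\<^sup>+ y. indicator S (f x + y) * indicator ?B x \<partial>lborel) = emeasure lborel S * indicator ?B x" .
  qed
  also have "\<dots> = emeasure lborel S * emeasure lborel ?B"
    by (subst nn_integral_cmult) auto
  finally have "emeasure lborel ?B * emeasure lborel (f -` S) = emeasure lborel ?B * emeasure lborel S"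
    by (simp add: mult.commute)
  with B show ?thesis by (auto simp: ennreal_mult_cancel_left)
qed

text \<open>\<open>eta\<close> is defined along one axis, whereas the offset between two vertices
  points anywhere; a rotation taking \<open>u\<close> to \<open>v\<close> maps one lens onto the
  other.\<close>

lemma measure_lens_rotate:
  fixes u v :: "real ^ 'n"
  assumes "norm u = norm v"
  shows "measure lborel (cball 0 1 \<inter> cball u 1) = measure lborel (cball 0 1 \<inter> cball v 1)"
proof -
  obtain f where f: "orthogonal_transformation f" "f u = v"
    using orthogonal_transformation_exists[OF assms] by blast
  then have lin: "linear f" and nrm: "norm (f x) = norm x" for x
    by (auto simp: orthogonal_transformation)
  have "f -` (cball 0 1 \<inter> cball v 1) = cball 0 1 \<inter> cball u 1"
    by (auto simp: nrm dist_norm linear_diff[OF lin, symmetric] simp flip: f(2))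
  then show ?thesis
    using emeasure_lborel_vimage_orthogonal[OF f(1), of "cball 0 1 \<inter> cball v 1"] by (simp add: measure_def)
qed

lemma measure_lens_scale:
  fixes u x :: "real ^ 'n"
  assumes "\<rho> > 0"
  shows "measure lborel (cball x \<rho> \<inter> cball (x + u) \<rho>) =
    \<rho> ^ CARD('n) * measure lborel (cball 0 1 \<inter> cball (u /\<^sub>R \<rho>) 1)"
proof -
  let ?S = "cball 0 1 \<inter> cball (u /\<^sub>R \<rho>) 1"
  have *: "cball x \<rho> \<inter> cball (x + u) \<rho> = (\<lambda>w. \<rho> *\<^sub>R w + x) ` ?S"
  proof (intro equalityI subsetI)
    fix w assume w: "w \<in> cball x \<rho> \<inter> cball (x + u) \<rho>"
    have "norm ((w - x) /\<^sub>R \<rho>) \<le> 1"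
      using w assms by (simp only: Int_iff mem_cball dist_norm norm_minus_commute[of x] norm_scaleR) (simp add: field_simps)
    moreover have "norm (u /\<^sub>R \<rho> - (w - x) /\<^sub>R \<rho>) \<le> 1"
    proof -
      have "u /\<^sub>R \<rho> - (w - x) /\<^sub>R \<rho> = (x + u - w) /\<^sub>R \<rho>" by (simp add: algebra_simps)
      then show ?thesis using w assms by (simp only: Int_iff mem_cball dist_norm norm_scaleR) (simp add: field_simps)
    qed
    ultimately show "w \<in> (\<lambda>w. \<rho> *\<^sub>R w + x) ` ?S"
      using assms by (intro image_eqI[of _ _ "(w - x) /\<^sub>R \<rho>"]) (auto simp: dist_norm)
  next
    fix w assume "w \<in> (\<lambda>w. \<rho> *\<^sub>R w + x) ` ?S"
    then obtain a where a: "w = \<rho> *\<^sub>R a + x" "a \<in> cball 0 1" "a \<in> cball (u /\<^sub>R \<rho>) 1" by blast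
    then have a: "w = \<rho> *\<^sub>R a + x" "norm a \<le> 1" "norm (u /\<^sub>R \<rho> - a) \<le> 1" by (auto simp: dist_norm)
    have "x + u - w = \<rho> *\<^sub>R (u /\<^sub>R \<rho> - a)" using assms by (simp add: a algebra_simps)
    then have "norm (x + u - w) \<le> \<rho>" using a assms by simp
    then show "w \<in> cball x \<rho> \<inter> cball (x + u) \<rho>" using a assms by (simp add: dist_norm)
  qed
  have S: "?S \<in> sets borel" "cball x \<rho> \<inter> cball (x + u) \<rho> \<in> sets borel" by auto
  have "measure lebesgue (cball x \<rho> \<inter> cball (x + u) \<rho>) = \<rho> ^ CARD('n) * measure lebesgue ?S"
    unfolding * using measure_lebesgue_affine[of \<rho> x ?S] assms by (simp add: add.commute)
  then show ?thesis using S by (simp only: measure_completion sets_lborel)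
qed

text \<open>Moved so that they are symmetric about the origin, the lenses are nested by convexity.\<close>

lemma measure_lens_mono:
  fixes v :: "real ^ 'n"
  assumes "0 \<le> a" "a \<le> 1"
  shows "measure lborel (cball 0 1 \<inter> cball v 1) \<le> measure lborel (cball 0 1 \<inter> cball (a *\<^sub>R v) 1)"
proof -
  \<comment> \<open>The shift takes the centre \<open>v / 2\<close> of the first lens to the centre
    \<open>(a / 2) v\<close> of the second. The two norms to bound are then those of
    \<open>w - t v\<close> for \<open>t = (1 - a) / 2\<close> and \<open>t = (1 + a) / 2\<close>,
    convex combinations of \<open>w\<close> and \<open>w - v\<close>.\<close>
  have "measure lborel (cball 0 1 \<inter> cball v 1) = measure lborel ((+) (- ((1 - a) / 2) *\<^sub>R v) ` (cball 0 1 \<inter> cball v 1))"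
    by (rule measure_lborel_translation[symmetric]) auto
  also have "\<dots> \<le> measure lborel (cball 0 1 \<inter> cball (a *\<^sub>R v) 1)"
  proof (rule measure_mono_fmeasurable)
    have conv: "norm (w - t *\<^sub>R v) \<le> 1" if "norm w \<le> 1" "norm (w - v) \<le> 1" "0 \<le> t" "t \<le> 1" for w t
    proof -
      have "w - t *\<^sub>R v = (1 - t) *\<^sub>R w + t *\<^sub>R (w - v)" by (simp add: algebra_simps)
      also have "norm \<dots> \<le> (1 - t) * norm w + t * norm (w - v)"
        using that by (intro norm_triangle_le add_mono) auto
      also have "\<dots> \<le> (1 - t) * 1 + t * 1" using that by (intro add_mono mult_left_mono) auto
      finally show ?thesis by simp
    qed
    show "(+) (- ((1 - a) / 2) *\<^sub>R v) ` (cball 0 1 \<inter> cball v 1) \<subseteq> cball 0 1 \<inter> cball (a *\<^sub>R v) 1"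
    proof safe
      fix w assume "w \<in> cball 0 1" "w \<in> cball v 1"
      then have w: "norm w \<le> 1" "norm (w - v) \<le> 1" by (auto simp: dist_norm norm_minus_commute)
      show "- ((1 - a) / 2) *\<^sub>R v + w \<in> cball 0 1"
        using conv[OF w, of "(1 - a) / 2"] assms by simp
      have "- ((1 - a) / 2) *\<^sub>R v + w - a *\<^sub>R v = w - ((1 + a) / 2) *\<^sub>R v"
        by (simp add: vec_eq_iff field_simps)
      then show "- ((1 - a) / 2) *\<^sub>R v + w \<in> cball (a *\<^sub>R v) 1"
        using conv[OF w, of "(1 + a) / 2"] assms
        by (simp only: mem_cball dist_norm norm_minus_commute[of "a *\<^sub>R v"]) simp
    qed
    have "compact ((+) (- ((1 - a) / 2) *\<^sub>R v) ` (cball 0 1 \<inter> cball v 1))"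
      by (intro compact_translation compact_Int) auto
    then show "(+) (- ((1 - a) / 2) *\<^sub>R v) ` (cball 0 1 \<inter> cball v 1) \<in> sets lborel"
      by (simp add: compact_imp_closed)
  qed (intro fmeasurable_lborel_bounded, auto)
  finally show ?thesis .
qed

lemma eta_eq_lens:
  fixes v :: "real ^ 'n"
  assumes "norm v = s powr (1 / real CARD('n))"
  shows "measure lborel (cball 0 1 \<inter> cball v 1) = theta TYPE('n) * eta TYPE('n) s"
proof -
  have "norm (s powr (1 / real CARD('n)) *\<^sub>R e1 :: real ^ 'n) = norm v"
    using assms by (simp add: e1_def)
  from measure_lens_rotate[OF this] theta_pos[where 'n = 'n] show ?thesis by (simp add: eta_def)
qed

lemma eta_nonneg: "eta TYPE('n::finite) s \<ge> 0"
  using theta_pos[where 'n = 'n] by (simp add: eta_def)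

text \<open>After scaling to radius 1, \<open>u\<close> is a multiple, with factor at most 1, of a
  vector whose length is the one in \<open>eta s\<close>. Moving the centres closer only enlarges
  the lens.\<close>

lemma measure_lens_ge_eta:
  fixes x u :: "real ^ 'n"
  assumes "\<rho> > 0" "norm u \<le> s powr (1 / real CARD('n)) * \<rho>"
  shows "measure lborel (cball x \<rho> \<inter> cball (x + u) \<rho>) \<ge> \<rho> ^ CARD('n) * theta TYPE('n) * eta TYPE('n) s"
proof -
  define t where "t = s powr (1 / real CARD('n))"
  have t: "t \<ge> 0" "norm (u /\<^sub>R \<rho>) \<le> t" using assms by (auto simp: t_def field_simps)
  have "\<exists>v a. norm v = t \<and> 0 \<le> a \<and> a \<le> 1 \<and> u /\<^sub>R \<rho> = a *\<^sub>R v"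
  proof (cases "u = 0")
    case True
    \<comment> \<open>\<open>u = 0\<close> has no direction; any vector of the right length serves,
      with factor 0.\<close>
    then show ?thesis using t vector_choose_size[of t, where 'a = "real ^ 'n"] by (metis scaleR_zero_left scaleR_zero_right zero_le_one order_refl)
  next
    case False
    define w where "w = u /\<^sub>R \<rho>"
    have w: "norm w > 0" "norm w \<le> t" using False assms t by (simp_all add: w_def)
    then have "t > 0" by linarith
    have "norm ((t / norm w) *\<^sub>R w) = t" using w \<open>t > 0\<close> by simp
    moreover have "w = (norm w / t) *\<^sub>R ((t / norm w) *\<^sub>R w)" using w \<open>t > 0\<close> by simp
    moreover have "0 \<le> norm w / t" "norm w / t \<le> 1" using w \<open>t > 0\<close> by auto
    ultimately show ?thesis unfolding w_def[symmetric] by blast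
  qed
  then obtain v a where v: "norm v = t" "0 \<le> a" "a \<le> 1" "u /\<^sub>R \<rho> = a *\<^sub>R v" by blast
  have "theta TYPE('n) * eta TYPE('n) s = measure lborel (cball 0 1 \<inter> cball v 1)"
    using eta_eq_lens[of v s] v by (simp add: t_def)
  also have "\<dots> \<le> measure lborel (cball 0 1 \<inter> cball (u /\<^sub>R \<rho>) 1)"
    unfolding v(4) by (rule measure_lens_mono[OF v(2,3)])
  finally show ?thesis
    using assms by (simp add: measure_lens_scale mult.assoc)
qed

section \<open>Grids and nets\<close>

lemma torus_grid:
  assumes "0 < \<epsilon>" "\<epsilon> \<le> 1"
  shows "\<exists>G :: (real ^ 'n) set. finite G \<and> real (card G) \<le> (3 * real CARD('n) / \<epsilon>) ^ CARD('n) \<and>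
     (\<forall>x\<in>torus. \<exists>p\<in>G. norm (x - p) \<le> \<epsilon>)"
proof -
  let ?d = "real CARD('n)"
  \<comment> \<open>Rounding to multiples of \<open>1 / m\<close> costs at most
    \<open>?d / m\<close> in the sum norm, hence in the Euclidean norm. The count stays explicit in
    \<open>\<epsilon>\<close>, which later shrinks with the radius; as
    \<open>?d / \<epsilon> \<ge> 1\<close>, the 3 absorbs rounding up and the extra end
    point.\<close>
  define m where "m = nat \<lceil>?d / \<epsilon>\<rceil>"
  have d: "?d \<ge> 1" using zero_less_card_finite[where 'a = 'n] by linarith
  have ge1: "?d / \<epsilon> \<ge> 1" using order_trans[OF assms(2) d] assms(1) by (simp only: le_divide_eq_1_pos)
  have m: "real m \<ge> ?d / \<epsilon>" "real m \<le> ?d / \<epsilon> + 1" unfolding m_def using ge1 by linarith+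
  have mpos: "real m > 0" using m(1) ge1 by linarith
  let ?F = "PiE UNIV (\<lambda>_ :: 'n. {..m})"
  let ?g = "\<lambda>k :: 'n \<Rightarrow> nat. (\<chi> i. real (k i) / real m) :: real ^ 'n"
  have fin: "finite ?F" by (intro finite_PiE) auto
  have "card (?g ` ?F) \<le> card ?F" by (rule card_image_le[OF fin])
  also have "card ?F = (m + 1) ^ CARD('n)" by (simp add: card_PiE)
  finally have "real (card (?g ` ?F)) \<le> real ((m + 1) ^ CARD('n))" by (simp only: of_nat_le_iff)
  also have "\<dots> = (real m + 1) ^ CARD('n)" by (simp add: add.commute)
  also have "\<dots> \<le> (3 * ?d / \<epsilon>) ^ CARD('n)"
    using m ge1 by (intro power_mono) auto
  finally have "real (card (?g ` ?F)) \<le> (3 * ?d / \<epsilon>) ^ CARD('n)" .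
  moreover have "\<exists>p\<in>?g ` ?F. norm (x - p) \<le> \<epsilon>" if x: "x \<in> torus" for x
  proof
    let ?k = "\<lambda>i. nat \<lfloor>real m * x $ i\<rfloor>"
    have x01: "0 \<le> x $ i" "x $ i \<le> 1" for i using x by (auto simp: torus_def)
    have "?k i \<le> m" for i
    proof -
      have "real m * x $ i \<le> real m * 1" using x01 by (intro mult_left_mono) auto
      then show ?thesis by linarith
    qed
    then show "?g ?k \<in> ?g ` ?F" by (intro imageI) auto
    have "\<bar>x $ i - ?g ?k $ i\<bar> \<le> 1 / real m" for i
    proof -
      have "0 \<le> real m * x $ i" using x01 by simp
      then have "\<bar>real m * x $ i - real (?k i)\<bar> \<le> 1" by linarith
      moreover have "x $ i - ?g ?k $ i = (real m * x $ i - real (?k i)) / real m"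
        using mpos by (simp add: diff_divide_distrib)
      ultimately show ?thesis using mpos by (simp add: abs_divide divide_right_mono)
    qed
    then have "(\<Sum>i\<in>UNIV. \<bar>(x - ?g ?k) $ i\<bar>) \<le> (\<Sum>i\<in>(UNIV :: 'n set). 1 / real m)"
      by (intro sum_mono) simp
    also have "\<dots> = ?d / real m" by simp
    also have "\<dots> \<le> \<epsilon>" using m(1) mpos assms(1) by (simp add: divide_le_eq mult.commute)
    finally show "norm (x - ?g ?k) \<le> \<epsilon>" by (rule order_trans[OF norm_le_l1_cart])
  qed
  ultimately show ?thesis using fin by (intro exI[of _ "?g ` ?F"]) auto
qed

lemma torus_ball_Diff_ge:
  fixes p q :: "real ^ 'n"
  assumes "0 \<le> a" "a < 1 / 2" "0 \<le> b" "b < 1 / 2"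
  shows "measure lborel (torus_ball p a - torus_ball q b) \<ge> theta TYPE('n) * (a ^ CARD('n) - b ^ CARD('n))"
proof -
  note fm = fmeasurable_torus_ball
  have "measure lborel (torus_ball p a) \<le> measure lborel (torus_ball q b \<union> torus_ball p a)"
    by (intro measure_mono_fmeasurable fmeasurable.Un fm) auto
  also have "\<dots> = measure lborel (torus_ball q b) + measure lborel (torus_ball p a - torus_ball q b)"
    by (intro measure_Un2 fm)
  finally show ?thesis using assms by (simp add: measure_torus_ball algebra_simps)
qed

lemma torus_lens_ge:
  fixes p u :: "real ^ 'n"
  assumes "0 < \<rho>" "\<rho> < 1 / 2" "norm u \<le> s powr (1 / real CARD('n)) * \<rho>"
  shows "measure lborel (torus_ball p \<rho> \<inter> torus_ball (p + u) \<rho>) \<ge> \<rho> ^ CARD('n) * theta TYPE('n) * eta TYPE('n) s"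
proof -
  let ?L = "cball p \<rho> \<inter> cball (p + u) \<rho>"
  have "\<rho> ^ CARD('n) * theta TYPE('n) * eta TYPE('n) s \<le> measure lborel ?L"
    by (rule measure_lens_ge_eta[OF assms(1,3)])
  also have "\<dots> = measure lborel (torus_lift ?L)"
    using assms by (intro measure_torus_lift_subset_cball[symmetric, of _ p \<rho>]) auto
  also have "\<dots> \<le> measure lborel (torus_ball p \<rho> \<inter> torus_ball (p + u) \<rho>)"
  proof (rule measure_mono_fmeasurable)
    show "torus_lift ?L \<subseteq> torus_ball p \<rho> \<inter> torus_ball (p + u) \<rho>"
      unfolding torus_ball_eq_lift torus_lift_def by blast
    show "torus_ball p \<rho> \<inter> torus_ball (p + u) \<rho> \<in> fmeasurable lborel"
      by (rule fmeasurable_Int_fmeasurable[OF fmeasurable_torus_ball]) simp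
  qed (simp add: torus_lift_borel)
  finally show ?thesis .
qed

text \<open>Offsets are measured in units of the radius, so that one finite set serves for every
  \<open>n\<close>. Its points stay within \<open>cball 0 s\<close> because the lens estimate
  requires a bound on their norm.\<close>

definition net :: "real \<Rightarrow> real \<Rightarrow> (real ^ 'n) set \<Rightarrow> bool" where
  "net s \<delta> N \<longleftrightarrow> finite N \<and> N \<subseteq> cball 0 s \<and> (\<forall>w\<in>cball 0 s. \<exists>v\<in>N. norm (w - v) \<le> \<delta>)"

lemma net_exists:
  assumes "\<delta> > 0"
  shows "\<exists>N :: (real ^ 'n) set. net s \<delta> N"
proof -
  have "compact (cball (0 :: real ^ 'n) s)" by simp
  then have "\<exists>N. finite N \<and> N \<subseteq> cball (0 :: real ^ 'n) s \<and> cball 0 s \<subseteq> (\<Union>x\<in>N. ball x \<delta>)"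
    using seq_compact_imp_totally_bounded[OF compact_imp_seq_compact] assms by blast
  then obtain N where N: "finite N" "N \<subseteq> cball (0 :: real ^ 'n) s" "cball 0 s \<subseteq> (\<Union>x\<in>N. ball x \<delta>)"
    by (elim exE conjE)
  have "\<exists>v\<in>N. norm (w - v) \<le> \<delta>" if "w \<in> cball 0 s" for w :: "real ^ 'n"
  proof -
    have "w \<in> (\<Union>x\<in>N. ball x \<delta>)" using N(3) that by (rule subsetD)
    then obtain v where "v \<in> N" "w \<in> ball v \<delta>" by (rule UN_E)
    then show ?thesis by (intro bexI[of _ v]) (simp_all add: dist_norm norm_minus_commute)
  qed
  with N show ?thesis unfolding net_def by blast
qed

text \<open>One \<open>\<delta>\<close> pays for replacing \<open>x\<close> by \<open>p\<close>, the
  other for rounding the rescaled displacement from \<open>x\<close> to \<open>y\<close>. The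
  lattice vectors realising the two distances add up.\<close>

lemma torus_dist_near_net:
  fixes x y p :: "real ^ 'n"
  assumes net: "net s \<delta> N" and r: "r > 0" and d: "torus_dist x p \<le> \<delta> * r" "torus_dist y x \<le> s * r"
  shows "\<exists>v\<in>N. torus_dist y (p + r *\<^sub>R v) \<le> 2 * \<delta> * r"
proof -
  obtain z where z: "z \<in> int_lattice" "norm (y - x + z) \<le> s * r" using d(2) torus_dist_le_iff by blast
  obtain z' where z': "z' \<in> int_lattice" "norm (x - p + z') \<le> \<delta> * r" using d(1) torus_dist_le_iff by blast
  let ?w = "(y - x + z) /\<^sub>R r"
  have "norm ?w = norm (y - x + z) / r" using r by (simp only: norm_scaleR) (simp add: divide_inverse mult.commute)
  then have "?w \<in> cball 0 s" using z r by (simp add: pos_divide_le_eq)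
  then obtain v where v: "v \<in> N" "norm (?w - v) \<le> \<delta>" using net unfolding net_def by blast
  have "y - (p + r *\<^sub>R v) + (z + z') = r *\<^sub>R (?w - v) + (x - p + z')"
    using r by (simp add: algebra_simps)
  also have "norm \<dots> \<le> norm (r *\<^sub>R (?w - v)) + norm (x - p + z')" by (rule norm_triangle_ineq)
  also have "norm (r *\<^sub>R (?w - v)) = r * norm (?w - v)" using r by simp
  also have "r * norm (?w - v) + norm (x - p + z') \<le> r * \<delta> + \<delta> * r"
    using v z' r by (intro add_mono mult_left_mono) auto
  finally have "norm (y - (p + r *\<^sub>R v) + (z + z')) \<le> 2 * \<delta> * r" by (simp add: algebra_simps)
  then show ?thesis unfolding torus_dist_le_iff
    using v z z' by (intro bexI[of _ v] bexI[of _ "z + z'"] int_lattice_add) auto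
qed

section \<open>Measurability\<close>

lemma space_config_space: "space config_space = {S. finite S \<and> S \<subseteq> torus}"
  unfolding config_space_def by (rule space_measure_of) auto

lemma measurable_card_config:
  assumes "A \<in> sets borel"
  shows "(\<lambda>S. card (S \<inter> A)) \<in> measurable config_space (count_space UNIV)"
proof (subst measurable_count_space_eq2_countable, intro conjI ballI)
  fix k :: nat
  have "(\<lambda>S. card (S \<inter> A)) -` {k} \<inter> space config_space
      = {S. finite S \<and> S \<subseteq> torus \<and> card (S \<inter> A) = k}"
    by (auto simp: space_config_space)
  also have "\<dots> \<in> sets config_space"
    unfolding config_space_def using assms
    by (subst sets_measure_of) (auto intro!: sigma_sets.Basic)
  finally show "(\<lambda>S. card (S \<inter> A)) -` {k} \<inter> space config_space \<in> sets config_space" .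
qed auto

lemma void_sets:
  fixes A :: "(real ^ 'n) set"
  assumes "A \<in> sets borel"
  shows "{S \<in> space config_space. S \<inter> A = {}} \<in> sets config_space"
proof -
  have [measurable]: "(\<lambda>S. card (S \<inter> A)) \<in> measurable config_space (count_space UNIV)"
    by (rule measurable_card_config[OF assms])
  have "{S \<in> space config_space. S \<inter> A = {}} = {S \<in> space config_space. card (S \<inter> A) = 0}"
    by (auto simp: space_config_space card_eq_0_iff)
  also have "\<dots> \<in> sets config_space" by measurable
  finally show ?thesis .
qed

text \<open>The \<sigma>-algebra on configurations sees only counts of fixed Borel sets. Sets
  varying with a parameter are reached from rectangles by the \<pi>-\<lambda> theorem; counting in
  \<open>ennreal\<close> turns countable disjoint unions into sums.\<close>

lemma borel_measurable_count_section:
  fixes B :: "('a \<times> (real ^ 'n)) set"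
  assumes "B \<in> sets (X \<Otimes>\<^sub>M borel)"
  shows "(\<lambda>(x, S). emeasure (count_space UNIV) (S \<inter> Pair x -` B)) \<in> borel_measurable (X \<Otimes>\<^sub>M config_space)"
  using Int_stable_pair_measure_generator pair_measure_closed assms unfolding sets_pair_measure
proof (induct rule: sigma_sets_induct_disjoint)
  case empty
  show ?case by simp
next
  case (basic B)
  then obtain C A where [measurable]: "C \<in> sets X" "A \<in> sets borel" and B: "B = C \<times> A" by auto
  have [measurable]: "(\<lambda>S. card (S \<inter> A)) \<in> measurable config_space (count_space UNIV)"
    by (rule measurable_card_config) simp
  have "(\<lambda>(x, S). indicator C x * ennreal (real (card (S \<inter> A)))) \<in> borel_measurable (X \<Otimes>\<^sub>M config_space)"
    by measurable
  moreover have "(case w of (x, S) \<Rightarrow> emeasure (count_space UNIV) (S \<inter> Pair x -` B))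
      = (case w of (x, S) \<Rightarrow> indicator C x * ennreal (real (card (S \<inter> A))))"
    if "w \<in> space (X \<Otimes>\<^sub>M config_space)" for w
    using that by (cases w) (auto simp: B space_pair_measure space_config_space emeasure_count_space indicator_def
      ennreal_of_nat_eq_real_of_nat)
  ultimately show ?case by (subst measurable_cong) auto
next
  case (compl B)
  have [measurable]: "(\<lambda>S. card (S \<inter> UNIV)) \<in> measurable config_space (count_space UNIV)"
    by (rule measurable_card_config) simp
  \<comment> \<open>Configurations are finite, so the complement is counted by a genuine
    subtraction.\<close>
  have "(\<lambda>w. ennreal (real (card (snd w \<inter> UNIV))) - (case w of (x, S) \<Rightarrow> emeasure (count_space UNIV) (S \<inter> Pair x -` B)))
      \<in> borel_measurable (X \<Otimes>\<^sub>M config_space)"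
    using compl(2) by measurable
  moreover have "(case w of (x, S) \<Rightarrow> emeasure (count_space UNIV) (S \<inter> Pair x -` (space X \<times> space borel - B)))
      = ennreal (real (card (snd w \<inter> UNIV))) - (case w of (x, S) \<Rightarrow> emeasure (count_space UNIV) (S \<inter> Pair x -` B))"
    if "w \<in> space (X \<Otimes>\<^sub>M config_space)" for w
  proof -
    obtain x S where w: "w = (x, S)" by (cases w)
    have x: "x \<in> space X" and S: "finite S" using that by (auto simp: w space_pair_measure space_config_space)
    have "S \<inter> Pair x -` (space X \<times> space borel - B) = S - S \<inter> Pair x -` B" using x by auto
    then show ?thesis using S
      by (simp add: w emeasure_count_space card_Diff_subset ennreal_of_nat_eq_real_of_nat of_nat_diff card_mono
        flip: ennreal_minus)
  qed
  ultimately show ?case by (subst measurable_cong) auto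
next
  case (union A)
  have "(\<lambda>w. \<Sum>i. (case w of (x, S) \<Rightarrow> emeasure (count_space UNIV) (S \<inter> Pair x -` A i)))
      \<in> borel_measurable (X \<Otimes>\<^sub>M config_space)"
    using union(3) by measurable
  moreover have "(case w of (x, S) \<Rightarrow> emeasure (count_space UNIV) (S \<inter> Pair x -` (\<Union>i. A i)))
      = (\<Sum>i. (case w of (x, S) \<Rightarrow> emeasure (count_space UNIV) (S \<inter> Pair x -` A i)))" for w
  proof -
    obtain x S where w: "w = (x, S)" by (cases w)
    have "(\<Sum>i. emeasure (count_space UNIV) (S \<inter> Pair x -` A i))
        = emeasure (count_space UNIV) (\<Union>i. S \<inter> Pair x -` A i)"
      using union(1) by (intro suminf_emeasure) (auto simp: disjoint_family_on_def)
    also have "(\<Union>i. S \<inter> Pair x -` A i) = S \<inter> Pair x -` (\<Union>i. A i)" by auto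
    finally show ?thesis by (simp add: w)
  qed
  ultimately show ?case by (subst measurable_cong) auto
qed

text \<open>Evaluates the previous count along the map from \<open>x\<close> to
  \<open>(x, g x)\<close>; thus \<open>P x\<close> may refer to the very configuration whose points
  are counted, as isolation does.\<close>

lemma measurable_card_section:
  fixes g :: "'a \<Rightarrow> (real ^ 'n) set"
  assumes g: "g \<in> measurable X config_space"
    and P: "Measurable.pred (X \<Otimes>\<^sub>M borel) (\<lambda>(x, a). P x a)"
  shows "(\<lambda>x. card (g x \<inter> {a. P x a})) \<in> measurable X (count_space UNIV)"
proof (subst measurable_count_space_eq2_countable, intro conjI ballI)
  fix k :: nat
  let ?B = "{w \<in> space (X \<Otimes>\<^sub>M borel). case w of (x, a) \<Rightarrow> P x a}"
  have "?B \<in> sets (X \<Otimes>\<^sub>M borel)" using P by measurable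
  note m = borel_measurable_count_section[OF this]
  have "(\<lambda>x. (x, g x)) \<in> measurable X (X \<Otimes>\<^sub>M config_space)" using g by measurable
  from measurable_compose[OF this m]
  have [measurable]: "(\<lambda>x. emeasure (count_space UNIV) (g x \<inter> Pair x -` ?B)) \<in> borel_measurable X" by simp
  have "(\<lambda>x. card (g x \<inter> {a. P x a})) -` {k} \<inter> space X
      = {x \<in> space X. emeasure (count_space UNIV) (g x \<inter> Pair x -` ?B) = ennreal (real k)}"
  proof -
    have "emeasure (count_space UNIV) (g x \<inter> Pair x -` ?B) = ennreal (real (card (g x \<inter> {a. P x a})))"
      if "x \<in> space X" for x
    proof -
      have "finite (g x)" using measurable_space[OF g that] by (simp add: space_config_space)
      moreover have "g x \<inter> Pair x -` ?B = g x \<inter> {a. P x a}" using that by (auto simp: space_pair_measure)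
      ultimately show ?thesis by (simp add: emeasure_count_space ennreal_of_nat_eq_real_of_nat)
    qed
    then show ?thesis by auto
  qed
  also have "\<dots> \<in> sets X" by measurable
  finally show "(\<lambda>x. card (g x \<inter> {a. P x a})) -` {k} \<inter> space X \<in> sets X" .
qed auto

text \<open>Makes quantifiers over random points measurable, and can be nested: isolation quantifies
  over vertices and, inside, over points of the second process.\<close>

lemma pred_bex_config:
  fixes g :: "'a \<Rightarrow> (real ^ 'n) set"
  assumes g: "g \<in> measurable X config_space"
    and P: "Measurable.pred (X \<Otimes>\<^sub>M borel) (\<lambda>(x, a). P x a)"
  shows "Measurable.pred X (\<lambda>x. \<exists>a\<in>g x. P x a)"
proof -
  have [measurable]: "(\<lambda>x. card (g x \<inter> {a. P x a})) \<in> measurable X (count_space UNIV)"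
    by (rule measurable_card_section[OF g P])
  have "Measurable.pred X (\<lambda>x. card (g x \<inter> {a. P x a}) \<noteq> 0)" by measurable
  moreover have "(\<exists>a\<in>g x. P x a) \<longleftrightarrow> card (g x \<inter> {a. P x a}) \<noteq> 0" if "x \<in> space X" for x
  proof -
    have "finite (g x)" using measurable_space[OF g that] by (simp add: space_config_space)
    then show ?thesis by (auto simp: card_eq_0_iff)
  qed
  ultimately show ?thesis
    using measurable_cong[of X "\<lambda>x. \<exists>a\<in>g x. P x a" "\<lambda>x. card (g x \<inter> {a. P x a}) \<noteq> 0"] by simp
qed

section \<open>Isolation and the largest nearest neighbour radius\<close>

definition isolated :: "(real ^ 'n) set \<Rightarrow> (real ^ 'n) set \<Rightarrow> real \<Rightarrow> real ^ 'n \<Rightarrow> bool" where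
  "isolated X Y r x \<longleftrightarrow>
     \<not> (\<exists>x'\<in>X. x' \<noteq> x \<and> (\<exists>y\<in>Y. torus_dist x y \<le> r \<and> torus_dist x' y \<le> r))"

text \<open>With \<open>X\<close> finite the edge set is finite, so degree 0 means that there is no
  edge, and is not the default value of \<open>card\<close> on an infinite set.\<close>

lemma num_isolated_eq:
  assumes "finite X"
  shows "num_isolated X Y r = card (X \<inter> {x. isolated X Y r x})"
proof -
  have "finite (ab_edges X Y r)"
    using assms by (intro finite_subset[of "ab_edges X Y r" "Pow X"]) (auto simp: ab_edges_def)
  then have "ab_degree X Y r x = 0 \<longleftrightarrow> {e \<in> ab_edges X Y r. x \<in> e} = {}" for x
    by (simp add: ab_degree_def)
  moreover have "{e \<in> ab_edges X Y r. x \<in> e} = {} \<longleftrightarrow> isolated X Y r x" if "x \<in> X" for x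
  proof
    assume empty: "{e \<in> ab_edges X Y r. x \<in> e} = {}"
    show "isolated X Y r x"
      unfolding isolated_def
    proof safe
      fix x' y assume "x' \<in> X" "x' \<noteq> x" "y \<in> Y" "torus_dist x y \<le> r" "torus_dist x' y \<le> r"
      with that have "{x, x'} \<in> ab_edges X Y r" unfolding ab_edges_def mem_Collect_eq by metis
      with empty show False by blast
    qed
  next
    assume iso: "isolated X Y r x"
    show "{e \<in> ab_edges X Y r. x \<in> e} = {}"
    proof (rule ccontr)
      assume "{e \<in> ab_edges X Y r. x \<in> e} \<noteq> {}"
      then obtain a b y where "a \<in> X" "b \<in> X" "a \<noteq> b" "y \<in> Y" "torus_dist a y \<le> r" "torus_dist b y \<le> r" "x \<in> {a, b}"
        unfolding ab_edges_def by blast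
      with iso show False unfolding isolated_def by auto
    qed
  qed
  ultimately have "{x \<in> X. ab_degree X Y r x = 0} = X \<inter> {x. isolated X Y r x}" by blast
  then show ?thesis by (simp add: num_isolated_def)
qed

lemma num_isolated_pos_iff:
  assumes "finite X"
  shows "num_isolated X Y r > 0 \<longleftrightarrow> (\<exists>x\<in>X. isolated X Y r x)"
  using assms by (auto simp: num_isolated_eq card_gt_0_iff)

text \<open>Isolation is inherited by smaller radii, which settles one direction. For the other, it
  is an open condition: an edge appears only when one of finitely many thresholds is reached, so a
  vertex isolated at \<open>r\<close> is still isolated slightly beyond \<open>r\<close>, and the
  supremum exceeds \<open>r\<close>.\<close>

lemma largest_nn_radius_le_iff:
  assumes "finite X" "finite Y" "r \<ge> 0"
  shows "largest_nn_radius X Y \<le> ennreal r \<longleftrightarrow> num_isolated X Y r = 0"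
proof
  assume le: "largest_nn_radius X Y \<le> ennreal r"
  show "num_isolated X Y r = 0"
  proof (rule ccontr)
    assume "num_isolated X Y r \<noteq> 0"
    then obtain x where x: "x \<in> X" "isolated X Y r x"
      using num_isolated_pos_iff[OF assms(1)] by auto
    \<comment> \<open>The thresholds at which \<open>x\<close> acquires an edge;
      \<open>r + 1\<close> ensures that the minimum exists even if there are none.\<close>
    define T where "T = insert (r + 1) ((\<lambda>(x', y). max (torus_dist x y) (torus_dist x' y)) ` ((X - {x}) \<times> Y))"
    have T: "finite T" "T \<noteq> {}" using assms by (auto simp: T_def)
    have "\<forall>t\<in>T. r < t" using x(2) by (auto simp: T_def isolated_def not_le[symmetric])
    then have "r < Min T" using T by simp
    then obtain r' where r': "r < r'" "r' < Min T" using dense by blast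
    then have "\<forall>t\<in>T. r' < t" using T by simp
    have "isolated X Y r' x"
      unfolding isolated_def
    proof safe
      fix x' y assume *: "x' \<in> X" "x' \<noteq> x" "y \<in> Y" "torus_dist x y \<le> r'" "torus_dist x' y \<le> r'"
      then have "max (torus_dist x y) (torus_dist x' y) \<in> T" by (force simp: T_def)
      with \<open>\<forall>t\<in>T. r' < t\<close> have "r' < max (torus_dist x y) (torus_dist x' y)" by blast
      with * show False by simp
    qed
    with x(1) assms(1) have "num_isolated X Y r' > 0" using num_isolated_pos_iff by blast
    then have "ennreal r' \<le> largest_nn_radius X Y"
      unfolding largest_nn_radius_def using r' assms(3) by (intro Sup_upper) auto
    with le have "ennreal r' \<le> ennreal r" by (rule order_trans[rotated])
    then show False using r' assms(3) by simp
  qed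
next
  assume 0: "num_isolated X Y r = 0"
  show "largest_nn_radius X Y \<le> ennreal r"
    unfolding largest_nn_radius_def
  proof (safe intro!: Sup_least)
    fix r' assume "num_isolated X Y r' > 0"
    then obtain x where x: "x \<in> X" "isolated X Y r' x"
      using num_isolated_pos_iff[OF assms(1)] by auto
    have "\<not> isolated X Y r x" using 0 x(1) num_isolated_pos_iff[OF assms(1), of Y r] by auto
    with x(2) have "r' \<le> r" by (force simp: isolated_def)
    then show "ennreal r' \<le> ennreal r" by (rule ennreal_leI)
  qed
qed

lemma measurable_num_isolated:
  fixes f g :: "'a \<Rightarrow> (real ^ 'n) set"
  assumes f: "f \<in> measurable X config_space" and g: "g \<in> measurable X config_space"
  shows "(\<lambda>w. num_isolated (f w) (g w) r) \<in> measurable X (count_space UNIV)"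
proof -
  have f2: "(\<lambda>w. f (fst w)) \<in> measurable (X \<Otimes>\<^sub>M (borel :: (real ^ 'n) measure)) config_space"
    by (intro measurable_compose[OF measurable_fst f])
  have g2: "(\<lambda>w. g (fst (fst w))) \<in> measurable ((X \<Otimes>\<^sub>M (borel :: (real ^ 'n) measure)) \<Otimes>\<^sub>M (borel :: (real ^ 'n) measure)) config_space"
    by (intro measurable_compose[OF measurable_fst measurable_compose[OF measurable_fst g]])
  have "Measurable.pred (X \<Otimes>\<^sub>M borel) (\<lambda>(w, x). isolated (f w) (g w) r x)"
  proof -
    have [measurable]: "Measurable.pred ((X \<Otimes>\<^sub>M borel) \<Otimes>\<^sub>M borel)
       (\<lambda>w. \<exists>y\<in>g (fst (fst w)). torus_dist (snd (fst w)) y \<le> r \<and> torus_dist (snd w) y \<le> r)"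
      by (rule pred_bex_config[OF g2]) measurable
    have "Measurable.pred (X \<Otimes>\<^sub>M borel) (\<lambda>v. \<exists>x'\<in>f (fst v). x' \<noteq> snd v \<and>
        (\<exists>y\<in>g (fst v). torus_dist (snd v) y \<le> r \<and> torus_dist x' y \<le> r))"
    proof (rule pred_bex_config[OF f2])
      have "Measurable.pred ((X \<Otimes>\<^sub>M borel) \<Otimes>\<^sub>M borel) (\<lambda>w. snd w \<noteq> snd (fst w) \<and>
        (\<exists>y\<in>g (fst (fst w)). torus_dist (snd (fst w)) y \<le> r \<and> torus_dist (snd w) y \<le> r))"
        by measurable
      then show "Measurable.pred ((X \<Otimes>\<^sub>M borel) \<Otimes>\<^sub>M borel) (\<lambda>(v, x'). x' \<noteq> snd v \<and>
        (\<exists>y\<in>g (fst v). torus_dist (snd v) y \<le> r \<and> torus_dist x' y \<le> r))"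
        by (simp add: case_prod_beta')
    qed
    then have "Measurable.pred (X \<Otimes>\<^sub>M borel) (\<lambda>v. \<not> (\<exists>x'\<in>f (fst v). x' \<noteq> snd v \<and>
        (\<exists>y\<in>g (fst v). torus_dist (snd v) y \<le> r \<and> torus_dist x' y \<le> r)))"
      by (rule pred_intros_logic)
    then show ?thesis by (simp only: isolated_def case_prod_beta')
  qed
  from measurable_card_section[OF f this]
  have "(\<lambda>w. card (f w \<inter> {x. isolated (f w) (g w) r x})) \<in> measurable X (count_space UNIV)" .
  moreover have "num_isolated (f w) (g w) r = card (f w \<inter> {x. isolated (f w) (g w) r x})" if "w \<in> space X" for w
    using measurable_space[OF f that] by (intro num_isolated_eq) (simp add: space_config_space)
  ultimately show ?thesis
    using measurable_cong[of X "\<lambda>w. num_isolated (f w) (g w) r"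
      "\<lambda>w. card (f w \<inter> {x. isolated (f w) (g w) r x})"] by simp
qed

section \<open>Vacant volume\<close>

text \<open>Unlike \<open>poisson_pmf\<close>, meaningful also for mean 0, which occurs when the
  second process leaves no volume uncovered.\<close>

definition pois :: "nat \<Rightarrow> real \<Rightarrow> real" where
  "pois k m = m ^ k / fact k * exp (- m)"

lemma pois_nonneg: "m \<ge> 0 \<Longrightarrow> pois k m \<ge> 0"
  by (simp add: pois_def)

lemma pois_le_1:
  assumes "m \<ge> 0"
  shows "pois k m \<le> 1"
proof (cases "m = 0")
  case True
  then show ?thesis by (cases k) (auto simp: pois_def)
next
  case False
  then have "pois k m = pmf (poisson_pmf m) k" using assms by (simp add: pois_def)
  then show ?thesis by (simp add: pmf_le_1)
qed

lemma pois_has_derivative: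
  "(pois k has_real_derivative (if k = 0 then 0 else pois (k - 1) x) - pois k x) (at x)"
proof (cases k)
  case 0
  show ?thesis unfolding 0 pois_def by (auto intro!: derivative_eq_intros)
next
  case (Suc j)
  have "((\<lambda>m. m ^ Suc j / fact (Suc j)) has_real_derivative x ^ j / fact j) (at x)"
    using DERIV_cdivide[OF DERIV_pow[of "Suc j" x UNIV], of "fact (Suc j)"] by (simp del: of_nat_Suc)
  moreover have "((\<lambda>m. exp (- m)) has_real_derivative - exp (- x)) (at x)"
    by (auto intro!: derivative_eq_intros)
  ultimately have "((\<lambda>m. m ^ Suc j / fact (Suc j) * exp (- m)) has_real_derivative
     (x ^ j / fact j * exp (- x) + - exp (- x) * (x ^ Suc j / fact (Suc j)))) (at x)"
    by (rule DERIV_mult)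
  then show ?thesis unfolding Suc pois_def[abs_def] by (simp add: mult.commute)
qed

text \<open>The derivative is a difference of two values in \<open>[0, 1]\<close>. As the constant
  is uniform in the mean, an error in a random mean passes unchanged to the Poisson weights.\<close>

lemma pois_lipschitz:
  assumes "a \<ge> 0" "b \<ge> 0"
  shows "\<bar>pois k a - pois k b\<bar> \<le> \<bar>a - b\<bar>"
proof -
  have "norm (pois k a - pois k b) \<le> 1 * norm (a - b)"
  proof (rule field_differentiable_bound[where S = "{0..}"])
    show "convex {0 :: real..}" by simp
    fix x :: real assume "x \<in> {0..}"
    then have x: "x \<ge> 0" by simp
    show "(pois k has_real_derivative (if k = 0 then 0 else pois (k - 1) x) - pois k x) (at x within {0..})"
      using pois_has_derivative has_field_derivative_at_within by blast
    show "norm ((if k = 0 then 0 else pois (k - 1) x) - pois k x) \<le> 1"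
      using pois_nonneg[OF x, of k] pois_le_1[OF x, of k] pois_nonneg[OF x, of "k - 1"] pois_le_1[OF x, of "k - 1"]
      by (auto simp: abs_le_iff)
  qed (use assms in auto)
  then show ?thesis by simp
qed

lemma borel_measurable_pois [measurable]: "pois k \<in> borel_measurable borel"
  unfolding pois_def[abs_def] by measurable

text \<open>Conditioning on \<open>Y\<close> in the form of Fubini on the product law:
  \<open>h\<close> is the probability with \<open>Y\<close> frozen, so conditional expectations are
  avoided.\<close>

lemma (in prob_space) prob_indep_var_eq_integral:
  assumes indep: "indep_var S X T Y"
    and Q: "Measurable.pred (S \<Otimes>\<^sub>M T) (\<lambda>(x, y). Q x y)"
    and h: "h \<in> borel_measurable M"
    and eq: "\<And>\<omega>. \<omega> \<in> space M \<Longrightarrow> prob {\<omega>' \<in> space M. Q (X \<omega>') (Y \<omega>)} = h \<omega>"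
  shows "prob {\<omega> \<in> space M. Q (X \<omega>) (Y \<omega>)} = (\<integral>\<omega>. h \<omega> \<partial>M)"
proof -
  have [measurable]: "X \<in> measurable M S" "Y \<in> measurable M T"
    using indep indep_var_rv1 indep_var_rv2 by auto
  interpret S: prob_space "distr M S X" by (rule prob_space_distr) simp
  interpret T: prob_space "distr M T Y" by (rule prob_space_distr) simp
  interpret ST: pair_sigma_finite "distr M S X" "distr M T Y" ..
  let ?A = "{w \<in> space (S \<Otimes>\<^sub>M T). case w of (x, y) \<Rightarrow> Q x y}"
  have A: "?A \<in> sets (S \<Otimes>\<^sub>M T)" using Q by measurable
  have A': "?A \<in> sets (distr M S X \<Otimes>\<^sub>M distr M T Y)"
    using A by (simp cong: sets_pair_measure_cong)
  have h0: "h \<omega> \<ge> 0" if "\<omega> \<in> space M" for \<omega> unfolding eq[OF that, symmetric] by simp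
  have "emeasure M {\<omega> \<in> space M. Q (X \<omega>) (Y \<omega>)} = emeasure (distr M (S \<Otimes>\<^sub>M T) (\<lambda>\<omega>. (X \<omega>, Y \<omega>))) ?A"
    using A measurable_space[of X M S] measurable_space[of Y M T]
    by (subst emeasure_distr) (auto intro!: arg_cong[of _ _ "emeasure M"] simp: space_pair_measure)
  also have "\<dots> = emeasure (distr M S X \<Otimes>\<^sub>M distr M T Y) ?A"
    using indep by (simp add: indep_var_distribution_eq)
  also have "\<dots> = (\<integral>\<^sup>+ y. emeasure (distr M S X) ((\<lambda>x. (x, y)) -` ?A) \<partial>distr M T Y)"
    by (rule ST.emeasure_pair_measure_alt2[OF A'])
  also have "\<dots> = (\<integral>\<^sup>+ \<omega>. emeasure (distr M S X) ((\<lambda>x. (x, Y \<omega>)) -` ?A) \<partial>M)"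
    using ST.measurable_emeasure_Pair2[OF A'] by (intro nn_integral_distr) auto
  also have "\<dots> = (\<integral>\<^sup>+ \<omega>. ennreal (h \<omega>) \<partial>M)"
  proof (rule nn_integral_cong)
    fix \<omega> assume w: "\<omega> \<in> space M"
    have "(\<lambda>x. (x, Y \<omega>)) -` ?A \<in> sets S"
      using sets_Pair2[OF A] by simp
    then have "emeasure (distr M S X) ((\<lambda>x. (x, Y \<omega>)) -` ?A) = emeasure M (X -` ((\<lambda>x. (x, Y \<omega>)) -` ?A) \<inter> space M)"
      by (subst emeasure_distr) auto
    also have "X -` ((\<lambda>x. (x, Y \<omega>)) -` ?A) \<inter> space M = {\<omega>' \<in> space M. Q (X \<omega>') (Y \<omega>)}"
      using w measurable_space[of X M S] measurable_space[of Y M T] by (auto simp: space_pair_measure)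
    finally show "emeasure (distr M S X) ((\<lambda>x. (x, Y \<omega>)) -` ?A) = ennreal (h \<omega>)"
      using eq[OF w] by (simp add: emeasure_eq_measure)
  qed
  finally have "prob {\<omega> \<in> space M. Q (X \<omega>) (Y \<omega>)} = enn2real (\<integral>\<^sup>+ \<omega>. ennreal (h \<omega>) \<partial>M)"
    by (simp add: measure_def)
  also have "\<dots> = (\<integral>\<omega>. h \<omega> \<partial>M)"
    using h h0 by (intro integral_eq_nn_integral[symmetric]) auto
  finally show ?thesis .
qed

section \<open>First and second moment of the vacant volume\<close>

definition vacant :: "(real ^ 'n) set \<Rightarrow> real \<Rightarrow> (real ^ 'n) set" where
  "vacant S r = torus \<inter> {u. \<not> (\<exists>y\<in>S. torus_dist u y \<le> r)}"

lemma pred_vacant: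
  fixes g :: "'a \<Rightarrow> (real ^ 'n) set"
  assumes "g \<in> measurable X config_space"
  shows "Measurable.pred (X \<Otimes>\<^sub>M borel) (\<lambda>(x, u). u \<in> vacant (g x) r)"
proof -
  have [measurable]: "Measurable.pred (X \<Otimes>\<^sub>M (borel :: (real ^ 'n) measure)) (\<lambda>w. \<exists>y\<in>g (fst w). torus_dist (snd w) y \<le> r)"
    by (rule pred_bex_config[OF measurable_compose[OF measurable_fst assms]]) measurable
  have "Measurable.pred (X \<Otimes>\<^sub>M borel) (\<lambda>w. snd w \<in> torus \<and> \<not> (\<exists>y\<in>g (fst w). torus_dist (snd w) y \<le> r))"
    by measurable
  then show ?thesis by (simp only: vacant_def case_prod_beta' Int_iff mem_Collect_eq)
qed

lemma vacant_subset: "vacant S r \<subseteq> torus"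
  by (auto simp: vacant_def)

lemma vacant_borel:
  assumes "finite S"
  shows "vacant S r \<in> sets borel"
proof -
  have "vacant S r = torus - (\<Union>y\<in>S. torus_ball y r)"
    by (auto simp: vacant_def torus_ball_def)
  then show ?thesis using assms by (simp only:) (intro sets.Diff sets.finite_UN torus_borel torus_ball_borel)
qed

locale poisson_space = prob_space M for M :: "'w measure" +
  fixes P :: "'w \<Rightarrow> (real ^ 'n) set" and l :: real
  assumes poisson: "poisson_process M l P"
begin

lemma measurable_P [measurable]: "P \<in> measurable M config_space"
  using poisson by (simp add: poisson_process_def)

lemma finite_P: "\<omega> \<in> space M \<Longrightarrow> finite (P \<omega>)"
  and P_subset: "\<omega> \<in> space M \<Longrightarrow> P \<omega> \<subseteq> torus"
  using measurable_space[OF measurable_P] by (auto simp: space_config_space)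

lemma prob_card:
  assumes "A \<in> sets borel" "A \<subseteq> torus"
  shows "prob {\<omega> \<in> space M. card (P \<omega> \<inter> A) = k} = pois k (l * measure lborel A)"
  using poisson assms by (simp add: poisson_process_def pois_def)

lemma void_event: "A \<in> sets borel \<Longrightarrow> {\<omega> \<in> space M. P \<omega> \<inter> A = {}} \<in> events"
proof -
  assume A: "A \<in> sets borel"
  have "{\<omega> \<in> space M. P \<omega> \<inter> A = {}} = P -` {S \<in> space config_space. S \<inter> A = {}} \<inter> space M"
    using measurable_space[OF measurable_P] by auto
  then show ?thesis using measurable_sets[OF measurable_P void_sets[OF A]] by simp
qed

lemma prob_void:
  assumes "A \<in> sets borel" "A \<subseteq> torus"
  shows "prob {\<omega> \<in> space M. P \<omega> \<inter> A = {}} = exp (- (l * measure lborel A))"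
proof -
  have "{\<omega> \<in> space M. P \<omega> \<inter> A = {}} = {\<omega> \<in> space M. card (P \<omega> \<inter> A) = 0}"
    using finite_P by (auto simp: card_eq_0_iff)
  then show ?thesis using prob_card[OF assms, of 0] by (simp add: pois_def)
qed

definition vacancy :: "real \<Rightarrow> 'w \<Rightarrow> real" where
  "vacancy r \<omega> = measure lborel (vacant (P \<omega>) r)"

text \<open>An indicator of a set of pairs, so that joint measurability is a property of one set and
  Fubini applies.\<close>

abbreviation ind :: "real \<Rightarrow> 'w \<Rightarrow> real ^ 'n \<Rightarrow> ennreal" where
  "ind r \<omega> u \<equiv> indicator {(\<omega>, u). u \<in> vacant (P \<omega>) r} (\<omega>, u)"

lemma ind_measurable [measurable]: "(\<lambda>(\<omega>, u). ind r \<omega> u) \<in> borel_measurable (M \<Otimes>\<^sub>M borel)"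
  using pred_vacant[OF measurable_P, of r] by (simp add: case_prod_beta' Measurable.pred_def)

lemma emeasure_vacant:
  assumes "\<omega> \<in> space M"
  shows "emeasure lborel (vacant (P \<omega>) r) = ennreal (vacancy r \<omega>)"
    and "vacancy r \<omega> \<le> 1"
proof -
  have le: "emeasure lborel (vacant (P \<omega>) r) \<le> emeasure lborel (torus :: (real ^ 'n) set)"
    by (intro emeasure_mono vacant_subset) simp
  note t = emeasure_torus[where 'n = 'n]
  show *: "emeasure lborel (vacant (P \<omega>) r) = ennreal (vacancy r \<omega>)"
    unfolding vacancy_def using le t by (intro emeasure_eq_ennreal_measure) (auto simp: top_unique)
  show "vacancy r \<omega> \<le> 1" using le t by (simp add: *)
qed

lemma vacancy_nonneg: "vacancy r \<omega> \<ge> 0"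
  by (simp add: vacancy_def)

lemma nn_integral_ind:
  assumes "\<omega> \<in> space M"
  shows "(\<integral>\<^sup>+ u. ind r \<omega> u \<partial>lborel) = ennreal (vacancy r \<omega>)"
proof -
  have "(\<integral>\<^sup>+ u. ind r \<omega> u \<partial>lborel) = (\<integral>\<^sup>+ u. indicator (vacant (P \<omega>) r) u \<partial>lborel)"
    by (intro nn_integral_cong) (simp add: indicator_def)
  also have "\<dots> = emeasure lborel (vacant (P \<omega>) r)"
    using vacant_borel[OF finite_P[OF assms]] by (intro nn_integral_indicator) simp
  finally show ?thesis using emeasure_vacant[OF assms] by simp
qed

lemma vacancy_measurable [measurable]: "vacancy r \<in> borel_measurable M"
proof -
  have "(\<lambda>\<omega>. \<integral>\<^sup>+ u. ind r \<omega> u \<partial>lborel) \<in> borel_measurable M"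
    using ind_measurable by (intro lborel.borel_measurable_nn_integral) (simp cong: measurable_cong_sets sets_pair_measure_cong)
  then have "(\<lambda>\<omega>. enn2real (\<integral>\<^sup>+ u. ind r \<omega> u \<partial>lborel)) \<in> borel_measurable M" by measurable
  then show ?thesis using measurable_cong[of M "vacancy r" "\<lambda>\<omega>. enn2real (\<integral>\<^sup>+ u. ind r \<omega> u \<partial>lborel)"]
    by (simp add: nn_integral_ind vacancy_nonneg)
qed

text \<open>By symmetry of the distance, \<open>u\<close> and \<open>v\<close> are both vacant
  exactly when no point falls into the balls about them. Taking \<open>u = v\<close> also yields the
  first moment.\<close>

lemma nn_integral_ind_ind:
  assumes l: "l > 0"
  shows "(\<integral>\<^sup>+ \<omega>. ind r \<omega> u * ind r \<omega> v \<partial>M) =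
    indicator torus u * indicator torus v * ennreal (exp (- (l * measure lborel (torus_ball u r \<union> torus_ball v r))))"
proof (cases "u \<in> torus \<and> v \<in> torus")
  case True
  let ?A = "torus_ball u r \<union> torus_ball v r"
  have A: "?A \<in> sets borel" "?A \<subseteq> torus" by (auto simp: torus_ball_def)
  have "(\<integral>\<^sup>+ \<omega>. ind r \<omega> u * ind r \<omega> v \<partial>M) = (\<integral>\<^sup>+ \<omega>. indicator {\<omega> \<in> space M. P \<omega> \<inter> ?A = {}} \<omega> \<partial>M)"
  proof (rule nn_integral_cong)
    fix \<omega> assume w: "\<omega> \<in> space M"
    have "(u \<in> vacant (P \<omega>) r \<and> v \<in> vacant (P \<omega>) r) \<longleftrightarrow> P \<omega> \<inter> ?A = {}"
      using True P_subset[OF w] torus_dist_commute[of u] torus_dist_commute[of v]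
      by (fastforce simp: vacant_def torus_ball_def)
    then show "ind r \<omega> u * ind r \<omega> v = indicator {\<omega> \<in> space M. P \<omega> \<inter> ?A = {}} \<omega>"
      using w by (auto simp: indicator_def)
  qed
  also have "\<dots> = emeasure M {\<omega> \<in> space M. P \<omega> \<inter> ?A = {}}"
    by (rule nn_integral_indicator) (rule void_event[OF A(1)])
  finally show ?thesis using True prob_void[OF A] by (simp add: emeasure_eq_measure)
next
  case False
  then have "ind r \<omega> u * ind r \<omega> v = 0" for \<omega> using vacant_subset[of "P \<omega>" r] by (auto simp: indicator_def)
  then have "(\<integral>\<^sup>+ \<omega>. ind r \<omega> u * ind r \<omega> v \<partial>M) = 0" by (simp only: nn_integral_const mult_zero_left)
  then show ?thesis using False by (auto simp: indicator_def)
qed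

lemma pair_sigma_finite_lborel: "pair_sigma_finite M (lborel :: (real ^ 'n) measure)"
  by (intro pair_sigma_finite.intro sigma_finite_measure_axioms sigma_finite_lborel)

lemma ind_measurable2 [measurable]: "(\<lambda>(\<omega>, u). ind r \<omega> u) \<in> borel_measurable (M \<Otimes>\<^sub>M lborel)"
  using ind_measurable by (simp cong: measurable_cong_sets sets_pair_measure_cong)

text \<open>Robbins' formula. On the torus all balls of this radius have the same volume, so the
  mean has no boundary correction.\<close>

lemma nn_integral_vacancy:
  assumes l: "l > 0" and r: "0 \<le> r" "r < 1 / 2"
  shows "(\<integral>\<^sup>+ \<omega>. ennreal (vacancy r \<omega>) \<partial>M) = ennreal (exp (- (l * (theta TYPE('n) * r ^ CARD('n)))))"
proof -
  interpret pair_sigma_finite M "lborel :: (real ^ 'n) measure" by (rule pair_sigma_finite_lborel)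
  have "(\<integral>\<^sup>+ \<omega>. ennreal (vacancy r \<omega>) \<partial>M) = (\<integral>\<^sup>+ \<omega>. \<integral>\<^sup>+ u. ind r \<omega> u \<partial>lborel \<partial>M)"
    by (intro nn_integral_cong) (simp add: nn_integral_ind)
  also have "\<dots> = (\<integral>\<^sup>+ u. \<integral>\<^sup>+ \<omega>. ind r \<omega> u \<partial>M \<partial>lborel)"
    by (rule Fubini'[symmetric]) measurable
  also have "\<dots> = (\<integral>\<^sup>+ u. ennreal (exp (- (l * (theta TYPE('n) * r ^ CARD('n))))) * indicator (torus :: (real ^ 'n) set) u \<partial>lborel)"
  proof (rule nn_integral_cong)
    fix u :: "real ^ 'n"
    have "ind r \<omega> u = ind r \<omega> u * ind r \<omega> u" for \<omega> by (simp add: indicator_def)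
    then have "(\<integral>\<^sup>+ \<omega>. ind r \<omega> u \<partial>M) = (\<integral>\<^sup>+ \<omega>. ind r \<omega> u * ind r \<omega> u \<partial>M)" by simp
    also have "\<dots> = ennreal (exp (- (l * (theta TYPE('n) * r ^ CARD('n))))) * indicator torus u"
      unfolding nn_integral_ind_ind[OF l] using measure_torus_ball[OF r, of u] by (simp add: indicator_def)
    finally show "(\<integral>\<^sup>+ \<omega>. ind r \<omega> u \<partial>M) = \<dots>" .
  qed
  also have "\<dots> = ennreal (exp (- (l * (theta TYPE('n) * r ^ CARD('n)))))"
    by (subst nn_integral_cmult_indicator) (auto simp: emeasure_torus)
  finally show ?thesis .
qed

lemma nn_integral_vacancy_square:
  "(\<integral>\<^sup>+ \<omega>. ennreal ((vacancy r \<omega>)\<^sup>2) \<partial>M) = (\<integral>\<^sup>+ u. \<integral>\<^sup>+ v. \<integral>\<^sup>+ \<omega>. ind r \<omega> u * ind r \<omega> v \<partial>M \<partial>lborel \<partial>lborel)"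
proof -
  interpret pair_sigma_finite M "lborel :: (real ^ 'n) measure" by (rule pair_sigma_finite_lborel)
  have "(\<integral>\<^sup>+ \<omega>. ennreal ((vacancy r \<omega>)\<^sup>2) \<partial>M) = (\<integral>\<^sup>+ \<omega>. \<integral>\<^sup>+ u. \<integral>\<^sup>+ v. ind r \<omega> u * ind r \<omega> v \<partial>lborel \<partial>lborel \<partial>M)"
  proof (rule nn_integral_cong)
    fix \<omega> assume w: "\<omega> \<in> space M"
    have [measurable]: "(\<lambda>u. ind r \<omega> u) \<in> borel_measurable borel"
      using measurable_Pair2[OF ind_measurable w, of r] by simp
    have "(\<integral>\<^sup>+ u. \<integral>\<^sup>+ v. ind r \<omega> u * ind r \<omega> v \<partial>lborel \<partial>lborel) = (\<integral>\<^sup>+ u. ind r \<omega> u * ennreal (vacancy r \<omega>) \<partial>lborel)"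
      by (intro nn_integral_cong) (subst nn_integral_cmult, simp_all add: nn_integral_ind[OF w])
    also have "\<dots> = ennreal (vacancy r \<omega>) * ennreal (vacancy r \<omega>)"
      by (subst nn_integral_multc) (simp_all add: nn_integral_ind[OF w])
    finally show "ennreal ((vacancy r \<omega>)\<^sup>2) = (\<integral>\<^sup>+ u. \<integral>\<^sup>+ v. ind r \<omega> u * ind r \<omega> v \<partial>lborel \<partial>lborel)"
      by (simp add: power2_eq_square ennreal_mult vacancy_nonneg)
  qed
  also have "\<dots> = (\<integral>\<^sup>+ u. \<integral>\<^sup>+ \<omega>. \<integral>\<^sup>+ v. ind r \<omega> u * ind r \<omega> v \<partial>lborel \<partial>M \<partial>lborel)"
  proof (rule Fubini'[symmetric])
    have 1: "(\<lambda>w. ind r (fst (fst w)) (snd (fst w))) \<in> borel_measurable ((M \<Otimes>\<^sub>M lborel) \<Otimes>\<^sub>M lborel)"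
      using measurable_compose[OF measurable_fst ind_measurable2] by (simp add: case_prod_beta')
    have 2: "(\<lambda>w. (fst (fst w), snd w)) \<in> (M \<Otimes>\<^sub>M (lborel :: (real ^ 'n) measure)) \<Otimes>\<^sub>M (lborel :: (real ^ 'n) measure) \<rightarrow>\<^sub>M M \<Otimes>\<^sub>M lborel" by measurable
    have "(\<lambda>w. ind r (fst (fst w)) (snd (fst w)) * ind r (fst (fst w)) (snd w)) \<in> borel_measurable ((M \<Otimes>\<^sub>M lborel) \<Otimes>\<^sub>M lborel)"
      using 1 measurable_compose[OF 2 ind_measurable2] by (intro borel_measurable_times_ennreal) (simp_all add: case_prod_beta')
    then show "(\<lambda>(\<omega>, u). \<integral>\<^sup>+ v. ind r \<omega> u * ind r \<omega> v \<partial>lborel) \<in> borel_measurable (M \<Otimes>\<^sub>M lborel)"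
      by (intro lborel.borel_measurable_nn_integral_fst[of "\<lambda>w. ind r (fst (fst w)) (snd (fst w)) * ind r (fst (fst w)) (snd w)", simplified, unfolded case_prod_beta'] | simp add: case_prod_beta')+
  qed
  also have "\<dots> = (\<integral>\<^sup>+ u. \<integral>\<^sup>+ v. \<integral>\<^sup>+ \<omega>. ind r \<omega> u * ind r \<omega> v \<partial>M \<partial>lborel \<partial>lborel)"
  proof (intro nn_integral_cong Fubini'[symmetric])
    fix u :: "real ^ 'n"
    have 2: "(\<lambda>w. (fst w, u)) \<in> M \<Otimes>\<^sub>M (lborel :: (real ^ 'n) measure) \<rightarrow>\<^sub>M M \<Otimes>\<^sub>M lborel" by measurable
    show "(\<lambda>(\<omega>, v). ind r \<omega> u * ind r \<omega> v) \<in> borel_measurable (M \<Otimes>\<^sub>M lborel)"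
      using measurable_compose[OF 2 ind_measurable2] ind_measurable2
      by (simp only: case_prod_beta') (intro borel_measurable_times_ennreal, simp_all)
  qed
  finally show ?thesis .
qed

text \<open>Three regimes for the distance. Beyond \<open>2 * r\<close> the balls are disjoint and
  the probability factorises; up to \<open>\<rho> * r\<close> the volume of one ball is bound
  enough, since such pairs are rare; in between the linear gain in volume yields the factor
  \<open>exp (- (m * \<rho> / 4))\<close>.\<close>

lemma pair_void_bound:
  fixes u v :: "real ^ 'n"
  assumes l: "l > 0" and r: "0 < r" "r < 1 / 6" and \<rho>: "0 < \<rho>" and u: "u \<in> torus" and v: "v \<in> torus"
  defines "m \<equiv> l * (theta TYPE('n) * r ^ CARD('n))"
  shows "exp (- (l * measure lborel (torus_ball u r \<union> torus_ball v r))) \<le>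
    (exp (- m))\<^sup>2 + exp (- m) * indicator (torus_ball u (\<rho> * r)) v
     + exp (- m) * exp (- (m * \<rho> / 4)) * indicator (torus_ball u (2 * r)) v"
proof -
  have mball: "measure lborel (torus_ball w r) = theta TYPE('n) * r ^ CARD('n)" for w :: "real ^ 'n"
    using r by (intro measure_torus_ball) auto
  have m0: "m \<ge> 0" using l r theta_pos[where 'n = 'n] by (simp add: m_def)
  note fm = fmeasurable_torus_ball
  show ?thesis
  proof (cases "torus_dist u v \<le> 2 * r")
    case False
    have "torus_ball u r \<inter> torus_ball v r = {}"
    proof (rule ccontr)
      assume "torus_ball u r \<inter> torus_ball v r \<noteq> {}"
      then obtain w where "torus_dist w u \<le> r" "torus_dist w v \<le> r" by (auto simp: torus_ball_def)
      then show False using False torus_dist_triangle[of u v w] torus_dist_commute[of u w] by simp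
    qed
    then have "measure lborel (torus_ball u r \<union> torus_ball v r) = 2 * (theta TYPE('n) * r ^ CARD('n))"
      using fm[of u] fm[of v] mball by (subst measure_Un2) (simp_all add: Diff_triv Int_commute)
    then have "exp (- (l * measure lborel (torus_ball u r \<union> torus_ball v r))) = (exp (- m))\<^sup>2"
      by (simp add: m_def power2_eq_square algebra_simps flip: exp_add)
    then show ?thesis by simp
  next
    case True
    have td: "torus_dist u v \<ge> 0" by (simp add: torus_dist_eq_infdist infdist_nonneg)
    have "l * measure lborel (torus_ball u r \<union> torus_ball v r) \<ge> l * (theta TYPE('n) * r ^ CARD('n) * (1 + torus_dist u v / (4 * r)))"
      using l by (intro mult_left_mono measure_torus_ball_Un_ge r True) auto
    then have ge: "l * measure lborel (torus_ball u r \<union> torus_ball v r) \<ge> m * (1 + torus_dist u v / (4 * r))"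
      by (simp add: m_def mult.assoc)
    have in2: "v \<in> torus_ball u (2 * r)" using v True by (simp add: torus_ball_def torus_dist_commute[of v])
    show ?thesis
    proof (cases "torus_dist u v \<le> \<rho> * r")
      case True
      have "m * 1 \<le> m * (1 + torus_dist u v / (4 * r))" using m0 td r by (intro mult_left_mono) auto
      with ge have "exp (- (l * measure lborel (torus_ball u r \<union> torus_ball v r))) \<le> exp (- m)" by simp
      moreover have "v \<in> torus_ball u (\<rho> * r)" using v True by (simp add: torus_ball_def torus_dist_commute[of v])
      ultimately show ?thesis by (simp add: add_increasing add_increasing2)
    next
      case False
      then have "\<rho> / 4 \<le> torus_dist u v / (4 * r)" using r by (simp add: field_simps)
      then have "m * (1 + \<rho> / 4) \<le> m * (1 + torus_dist u v / (4 * r))" using m0 by (intro mult_left_mono) auto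
      with ge have "exp (- (l * measure lborel (torus_ball u r \<union> torus_ball v r))) \<le> exp (- (m * (1 + \<rho> / 4)))" by simp
      also have "\<dots> = exp (- m) * exp (- (m * \<rho> / 4))" by (simp add: algebra_simps flip: exp_add)
      finally show ?thesis using in2 by (simp add: add_increasing)
    qed
  qed
qed

lemma nn_integral_vacancy_square_le:
  assumes l: "l > 0" and r: "0 < r" "r < 1 / 6" and \<rho>: "0 < \<rho>" "\<rho> \<le> 2"
  defines "m \<equiv> l * (theta TYPE('n) * r ^ CARD('n))"
  shows "(\<integral>\<^sup>+ \<omega>. ennreal ((vacancy r \<omega>)\<^sup>2) \<partial>M) \<le>
    ennreal ((exp (- m))\<^sup>2 + exp (- m) * theta TYPE('n) * r ^ CARD('n) * (\<rho> ^ CARD('n) + 2 ^ CARD('n) * exp (- (m * \<rho> / 4))))"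
proof -
  let ?t = "theta TYPE('n)" and ?d = "CARD('n)"
  let ?b = "(exp (- m))\<^sup>2 + exp (- m) * ?t * r ^ ?d * (\<rho> ^ ?d + 2 ^ ?d * exp (- (m * \<rho> / 4)))"
  have em: "emeasure lborel (torus_ball u s) = ennreal (?t * s ^ ?d)" if "0 \<le> s" "s < 1 / 2" for u :: "real ^ 'n" and s
    using measure_torus_ball[OF that, of u] fmeasurable_torus_ball[of u s] by (simp add: emeasure_eq_measure2)
  have inner: "(\<integral>\<^sup>+ v. \<integral>\<^sup>+ \<omega>. ind r \<omega> u * ind r \<omega> v \<partial>M \<partial>lborel) \<le> ennreal ?b * indicator torus u" for u :: "real ^ 'n"
  proof (cases "u \<in> torus")
    case True
    let ?g = "\<lambda>v :: real ^ 'n. ennreal ((exp (- m))\<^sup>2) * indicator torus v + ennreal (exp (- m)) * indicator (torus_ball u (\<rho> * r)) v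
       + ennreal (exp (- m) * exp (- (m * \<rho> / 4))) * indicator (torus_ball u (2 * r)) v"
    have "(\<integral>\<^sup>+ v. \<integral>\<^sup>+ \<omega>. ind r \<omega> u * ind r \<omega> v \<partial>M \<partial>lborel) \<le> (\<integral>\<^sup>+ v. ?g v \<partial>lborel)"
    proof (rule nn_integral_mono)
      fix v :: "real ^ 'n"
      show "(\<integral>\<^sup>+ \<omega>. ind r \<omega> u * ind r \<omega> v \<partial>M) \<le> ?g v"
      proof (cases "v \<in> torus")
        case v: True
        have "(\<integral>\<^sup>+ \<omega>. ind r \<omega> u * ind r \<omega> v \<partial>M) = ennreal (exp (- (l * measure lborel (torus_ball u r \<union> torus_ball v r))))"
          using True v by (simp add: nn_integral_ind_ind[OF l])
        also have "\<dots> \<le> ennreal ((exp (- m))\<^sup>2 + exp (- m) * indicator (torus_ball u (\<rho> * r)) v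
           + exp (- m) * exp (- (m * \<rho> / 4)) * indicator (torus_ball u (2 * r)) v)"
          unfolding m_def by (intro ennreal_leI pair_void_bound l r \<rho> True v)
        also have "\<dots> = ?g v"
          using v by (simp add: ennreal_plus ennreal_mult ennreal_indicator)
        finally show ?thesis .
      next
        case False
        then show ?thesis by (simp add: nn_integral_ind_ind[OF l])
      qed
    qed
    also have "\<dots> = ennreal ((exp (- m))\<^sup>2) + ennreal (exp (- m)) * ennreal (?t * (\<rho> * r) ^ ?d)
       + ennreal (exp (- m) * exp (- (m * \<rho> / 4))) * ennreal (?t * (2 * r) ^ ?d)"
    proof -
      \<comment> \<open>From \<open>\<rho> \<le> 2\<close> and \<open>r < 1 / 6\<close>, both radii
        stay in the range where balls on the torus have Euclidean volume.\<close>
      have s: "0 \<le> \<rho> * r" "\<rho> * r < 1 / 2" "0 \<le> 2 * r" "2 * r < 1 / 2"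
        using r(1,2) \<rho>(1) mult_right_mono[OF \<rho>(2), of r] mult_nonneg_nonneg[of \<rho> r] by linarith+
      let ?g1 = "\<lambda>v :: real ^ 'n. ennreal ((exp (- m))\<^sup>2) * indicator torus v"
      let ?g2 = "\<lambda>v :: real ^ 'n. ennreal (exp (- m)) * indicator (torus_ball u (\<rho> * r)) v"
      let ?g3 = "\<lambda>v :: real ^ 'n. ennreal (exp (- m) * exp (- (m * \<rho> / 4))) * indicator (torus_ball u (2 * r)) v"
      have m: "?g1 \<in> borel_measurable lborel" "?g2 \<in> borel_measurable lborel" "?g3 \<in> borel_measurable lborel"
        by (intro borel_measurable_times_ennreal borel_measurable_const borel_measurable_indicator; simp)+
      have "(\<integral>\<^sup>+ v. ?g1 v + ?g2 v + ?g3 v \<partial>lborel) = (\<integral>\<^sup>+ v. ?g1 v + ?g2 v \<partial>lborel) + (\<integral>\<^sup>+ v. ?g3 v \<partial>lborel)"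
        by (intro nn_integral_add borel_measurable_add m)
      also have "(\<integral>\<^sup>+ v. ?g1 v + ?g2 v \<partial>lborel) = (\<integral>\<^sup>+ v. ?g1 v \<partial>lborel) + (\<integral>\<^sup>+ v. ?g2 v \<partial>lborel)"
        by (intro nn_integral_add m)
      also have "(\<integral>\<^sup>+ v. ?g1 v \<partial>lborel) = ennreal ((exp (- m))\<^sup>2)"
        by (subst nn_integral_cmult_indicator) (simp_all add: emeasure_torus)
      also have "(\<integral>\<^sup>+ v. ?g2 v \<partial>lborel) = ennreal (exp (- m)) * ennreal (?t * (\<rho> * r) ^ ?d)"
        by (subst nn_integral_cmult_indicator) (simp_all only: em[OF s(1,2)] sets_lborel torus_ball_borel)
      also have "(\<integral>\<^sup>+ v. ?g3 v \<partial>lborel) = ennreal (exp (- m) * exp (- (m * \<rho> / 4))) * ennreal (?t * (2 * r) ^ ?d)"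
        by (subst nn_integral_cmult_indicator) (simp_all only: em[OF s(3,4)] sets_lborel torus_ball_borel)
      finally show ?thesis .
    qed
    also have "\<dots> = ennreal ?b"
      using theta_pos[where 'n = 'n] r \<rho>
      by (simp flip: ennreal_plus ennreal_mult add: power_mult_distrib algebra_simps)
    finally show ?thesis using True by simp
  next
    case False
    then show ?thesis by (simp add: nn_integral_ind_ind[OF l])
  qed
  have "(\<integral>\<^sup>+ \<omega>. ennreal ((vacancy r \<omega>)\<^sup>2) \<partial>M) \<le> (\<integral>\<^sup>+ u. ennreal ?b * indicator (torus :: (real ^ 'n) set) u \<partial>lborel)"
    unfolding nn_integral_vacancy_square by (intro nn_integral_mono inner)
  also have "\<dots> = ennreal ?b"
    by (subst nn_integral_cmult_indicator) (auto simp: emeasure_torus)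
  finally show ?thesis .
qed

text \<open>The first moment is exactly \<open>exp (- m)\<close>, so the squared term in the second
  moment cancels and the rest bounds the variance, whose square root dominates the mean absolute
  deviation.\<close>

lemma expectation_vacancy_deviation:
  assumes l: "l > 0" and r: "0 < r" "r < 1 / 6" and \<rho>: "0 < \<rho>" "\<rho> \<le> 2"
  defines "m \<equiv> l * (theta TYPE('n) * r ^ CARD('n))"
  shows "expectation (\<lambda>\<omega>. \<bar>vacancy r \<omega> - exp (- m)\<bar>) \<le>
    sqrt (exp (- m) * theta TYPE('n) * r ^ CARD('n) * (\<rho> ^ CARD('n) + 2 ^ CARD('n) * exp (- (m * \<rho> / 4))))"
proof -
  let ?p = "exp (- m)"
  let ?e = "exp (- m) * theta TYPE('n) * r ^ CARD('n) * (\<rho> ^ CARD('n) + 2 ^ CARD('n) * exp (- (m * \<rho> / 4)))"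
  have e0: "?e \<ge> 0" using theta_pos[where 'n = 'n] r \<rho> by simp
  have bV: "AE \<omega> in M. norm (vacancy r \<omega>) \<le> 1" using emeasure_vacant vacancy_nonneg by (auto intro!: AE_I2)
  have iV: "integrable M (vacancy r)" by (rule integrable_const_bound[OF bV]) simp
  have iV2: "integrable M (\<lambda>\<omega>. (vacancy r \<omega>)\<^sup>2)"
    using emeasure_vacant vacancy_nonneg
    by (intro integrable_const_bound[of _ 1]) (auto intro!: AE_I2 power_le_one)
  have EV: "expectation (vacancy r) = ?p"
    using nn_integral_vacancy[OF l, of r] r by (subst integral_eq_nn_integral) (auto simp: vacancy_nonneg m_def)
  have "expectation (\<lambda>\<omega>. (vacancy r \<omega>)\<^sup>2) = enn2real (\<integral>\<^sup>+ \<omega>. ennreal ((vacancy r \<omega>)\<^sup>2) \<partial>M)"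
    by (intro integral_eq_nn_integral) auto
  also have "\<dots> \<le> enn2real (ennreal (?p\<^sup>2 + ?e))"
    using nn_integral_vacancy_square_le[OF l r \<rho>] by (intro enn2real_mono) (simp_all add: m_def)
  also have "\<dots> = ?p\<^sup>2 + ?e" using e0 by (intro enn2real_ennreal) simp
  finally have EV2: "expectation (\<lambda>\<omega>. (vacancy r \<omega>)\<^sup>2) \<le> ?p\<^sup>2 + ?e" .
  let ?D = "\<lambda>\<omega>. \<bar>vacancy r \<omega> - ?p\<bar>"
  have iD: "integrable M ?D" using iV by auto
  have D2: "(?D \<omega>)\<^sup>2 = (vacancy r \<omega>)\<^sup>2 - 2 * ?p * vacancy r \<omega> + ?p\<^sup>2" for \<omega>
    by (simp add: power2_eq_square algebra_simps)
  have iD2: "integrable M (\<lambda>\<omega>. (?D \<omega>)\<^sup>2)" unfolding D2 using iV iV2 by auto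
  have "expectation (\<lambda>\<omega>. (?D \<omega>)\<^sup>2) = expectation (\<lambda>\<omega>. (vacancy r \<omega>)\<^sup>2) - 2 * ?p * expectation (vacancy r) + ?p\<^sup>2"
    unfolding D2 using iV iV2 by (simp add: prob_space)
  also have "\<dots> \<le> ?e" using EV2 by (simp add: EV power2_eq_square algebra_simps)
  finally have "expectation (\<lambda>\<omega>. (?D \<omega>)\<^sup>2) \<le> ?e" .
  \<comment> \<open>Cauchy-Schwarz, read off from the nonnegative variance of
    \<open>?D\<close>.\<close>
  moreover have "(expectation ?D)\<^sup>2 \<le> expectation (\<lambda>\<omega>. (?D \<omega>)\<^sup>2)"
    using variance_positive[of ?D] variance_eq[OF iD iD2] by simp
  ultimately have "(expectation ?D)\<^sup>2 \<le> ?e" by linarith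
  then show ?thesis by (rule real_le_rsqrt)
qed

end

section \<open>Isolated vertices with a neighbouring point of the second process\<close>

locale ab_graph = X: poisson_space M P1 l1 + Y: poisson_space M P2 l2
  for M :: "'w measure" and P1 P2 :: "'w \<Rightarrow> (real ^ 'n) set" and l1 l2 :: real +
  assumes indep: "X.indep_var config_space P1 config_space P2"
    and l1: "l1 > 0" and l2: "l2 > 0"
begin

abbreviation prob where "prob \<equiv> measure M"

text \<open>For a frozen second process the vacant set is a fixed Borel set, so its count is
  Poisson; independence then mixes over the random volume.\<close>

lemma prob_card_vacant:
  "prob {\<omega> \<in> space M. card (P1 \<omega> \<inter> vacant (P2 \<omega>) r) = k} = (\<integral>\<omega>. pois k (l1 * Y.vacancy r \<omega>) \<partial>M)"
proof (rule X.prob_indep_var_eq_integral[OF indep, where Q = "\<lambda>S T. card (S \<inter> vacant T r) = k"])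
  have "(\<lambda>w. card (fst w \<inter> {u. u \<in> vacant (snd w) r})) \<in> measurable (config_space \<Otimes>\<^sub>M config_space) (count_space UNIV)"
    by (rule measurable_card_section[OF measurable_fst pred_vacant[OF measurable_snd]])
  then have [measurable]: "(\<lambda>w. card (fst w \<inter> vacant (snd w) r)) \<in> measurable (config_space \<Otimes>\<^sub>M config_space) (count_space UNIV)"
    by simp
  have "Measurable.pred (config_space \<Otimes>\<^sub>M config_space) (\<lambda>w. card (fst w \<inter> vacant (snd w) r) = k)" by measurable
  then show "Measurable.pred (config_space \<Otimes>\<^sub>M config_space) (\<lambda>(S, T). card (S \<inter> vacant T r) = k)"
    by (simp only: case_prod_beta')
  show "(\<lambda>\<omega>. pois k (l1 * Y.vacancy r \<omega>)) \<in> borel_measurable M" by measurable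
  fix \<omega> assume "\<omega> \<in> space M"
  then show "prob {\<omega>' \<in> space M. card (P1 \<omega>' \<inter> vacant (P2 \<omega>) r) = k} = pois k (l1 * Y.vacancy r \<omega>)"
    unfolding Y.vacancy_def by (intro X.prob_card vacant_borel Y.finite_P vacant_subset)
qed

lemma prob_card_vacant_bound:
  assumes r: "0 < r" "r < 1 / 6" and \<rho>: "0 < \<rho>" "\<rho> \<le> 2"
  defines "m \<equiv> l2 * (theta TYPE('n) * r ^ CARD('n))"
  shows "\<bar>prob {\<omega> \<in> space M. card (P1 \<omega> \<inter> vacant (P2 \<omega>) r) = k} - pois k (l1 * exp (- m))\<bar> \<le>
    l1 * sqrt (exp (- m) * theta TYPE('n) * r ^ CARD('n) * (\<rho> ^ CARD('n) + 2 ^ CARD('n) * exp (- (m * \<rho> / 4))))"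
proof -
  let ?p = "exp (- m)"
  have bV: "AE \<omega> in M. norm (Y.vacancy r \<omega>) \<le> 1" using Y.emeasure_vacant Y.vacancy_nonneg by (auto intro!: AE_I2)
  have iV: "integrable M (Y.vacancy r)" by (rule X.integrable_const_bound[OF bV]) simp
  have ip: "integrable M (\<lambda>\<omega>. pois k (l1 * Y.vacancy r \<omega>))"
    using l1 Y.vacancy_nonneg pois_nonneg pois_le_1
    by (intro X.integrable_const_bound[of _ 1]) (auto intro!: AE_I2)
  have "\<bar>(\<integral>\<omega>. pois k (l1 * Y.vacancy r \<omega>) \<partial>M) - pois k (l1 * ?p)\<bar> = \<bar>\<integral>\<omega>. pois k (l1 * Y.vacancy r \<omega>) - pois k (l1 * ?p) \<partial>M\<bar>"
    using ip by (simp add: X.prob_space)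
  also have "\<dots> \<le> (\<integral>\<omega>. \<bar>pois k (l1 * Y.vacancy r \<omega>) - pois k (l1 * ?p)\<bar> \<partial>M)"
    by (rule integral_abs_bound)
  also have "\<dots> \<le> (\<integral>\<omega>. l1 * \<bar>Y.vacancy r \<omega> - ?p\<bar> \<partial>M)"
  proof (rule integral_mono)
    fix \<omega>
    have "\<bar>pois k (l1 * Y.vacancy r \<omega>) - pois k (l1 * ?p)\<bar> \<le> \<bar>l1 * Y.vacancy r \<omega> - l1 * ?p\<bar>"
      using l1 Y.vacancy_nonneg[of r \<omega>] by (intro pois_lipschitz) auto
    also have "\<dots> = l1 * \<bar>Y.vacancy r \<omega> - ?p\<bar>" using l1 by (simp add: abs_mult flip: right_diff_distrib)
    finally show "\<bar>pois k (l1 * Y.vacancy r \<omega>) - pois k (l1 * ?p)\<bar> \<le> l1 * \<bar>Y.vacancy r \<omega> - ?p\<bar>" .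
  qed (use ip iV in auto)
  also have "\<dots> = l1 * (\<integral>\<omega>. \<bar>Y.vacancy r \<omega> - ?p\<bar> \<partial>M)" by simp
  also have "\<dots> \<le> l1 * sqrt (?p * theta TYPE('n) * r ^ CARD('n) * (\<rho> ^ CARD('n) + 2 ^ CARD('n) * exp (- (m * \<rho> / 4))))"
    unfolding m_def using l1 by (intro mult_left_mono Y.expectation_vacancy_deviation l2 r \<rho>) auto
  finally show ?thesis by (simp add: prob_card_vacant)
qed

lemma prob_void_void:
  assumes "A \<in> sets borel" "A \<subseteq> torus" "B \<in> sets borel" "B \<subseteq> torus"
  shows "prob {\<omega> \<in> space M. P1 \<omega> \<inter> A = {} \<and> P2 \<omega> \<inter> B = {}} =
    exp (- (l1 * measure lborel A)) * exp (- (l2 * measure lborel B))"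
proof -
  let ?V = "\<lambda>A. {S \<in> space config_space. S \<inter> A = {}}"
  have eq: "P1 -` ?V A \<inter> space M = {\<omega> \<in> space M. P1 \<omega> \<inter> A = {}}" "P2 -` ?V B \<inter> space M = {\<omega> \<in> space M. P2 \<omega> \<inter> B = {}}"
    "(\<lambda>\<omega>. (P1 \<omega>, P2 \<omega>)) -` (?V A \<times> ?V B) \<inter> space M = {\<omega> \<in> space M. P1 \<omega> \<inter> A = {} \<and> P2 \<omega> \<inter> B = {}}"
    using measurable_space[OF X.measurable_P] measurable_space[OF Y.measurable_P] by auto
  show ?thesis
    using X.indep_varD[OF indep void_sets[OF assms(1)] void_sets[OF assms(3)]]
      X.prob_void[OF assms(1,2)] Y.prob_void[OF assms(3,4)] by (simp only: eq)
qed

text \<open>An isolated \<open>x\<close> with some \<open>y\<close> within \<open>r\<close> either has no other vertex within \<open>s r\<close>, or it has one, \<open>x'\<close>;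
  then the ball about \<open>y\<close> contains no vertex but \<open>x\<close>, and the lens of the balls about \<open>x\<close> and \<open>x'\<close>
  contains no point of the second process.  Here \<open>x\<close> is approximated by \<open>p\<close>, and \<open>x'\<close>, \<open>y\<close> by
  \<open>p + r u\<close>, \<open>p + r v\<close>.\<close>

lemma num_isolated_bad_cases:
  fixes N N' :: "(real ^ 'n) set"
  assumes w: "\<omega> \<in> space M" and r: "r > 0" and \<delta>: "0 < \<delta>"
    and G: "\<And>x. x \<in> torus \<Longrightarrow> \<exists>p\<in>G. norm (x - p) \<le> \<delta> * r"
    and N: "net s \<delta> N" and N': "net 1 \<delta> N'"
    and ne: "num_isolated (P1 \<omega>) (P2 \<omega>) r \<noteq> card (P1 \<omega> \<inter> vacant (P2 \<omega>) r)"
  shows "\<exists>p\<in>G. P1 \<omega> \<inter> (torus_ball p ((s - \<delta>) * r) - torus_ball p (\<delta> * r)) = {} \<or>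
    (\<exists>u\<in>N. \<exists>v\<in>N'. P1 \<omega> \<inter> (torus_ball (p + r *\<^sub>R v) ((1 - 2 * \<delta>) * r) - torus_ball p (\<delta> * r)) = {} \<and>
      P2 \<omega> \<inter> (torus_ball p ((1 - 2 * \<delta>) * r) \<inter> torus_ball (p + r *\<^sub>R u) ((1 - 2 * \<delta>) * r)) = {})"
proof -
  let ?X = "P1 \<omega>" and ?Y = "P2 \<omega>"
  have "?X \<inter> {x. isolated ?X ?Y r x} \<noteq> ?X \<inter> vacant ?Y r"
    using ne num_isolated_eq[OF X.finite_P[OF w]] by metis
  \<comment> \<open>A vacant vertex has no edge, so if the two sets differ, some isolated vertex is
    not vacant.\<close>
  moreover have "?X \<inter> vacant ?Y r \<subseteq> ?X \<inter> {x. isolated ?X ?Y r x}"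
    by (auto simp: vacant_def isolated_def)
  ultimately obtain x where x: "x \<in> ?X" "isolated ?X ?Y r x" "x \<notin> vacant ?Y r" by blast
  have xt: "x \<in> torus" using x(1) X.P_subset[OF w] by blast
  obtain y where y: "y \<in> ?Y" "torus_dist x y \<le> r" using x(3) xt by (auto simp: vacant_def)
  obtain p where p: "p \<in> G" "norm (x - p) \<le> \<delta> * r" using G[OF xt] by blast
  have xp: "torus_dist x p \<le> \<delta> * r" using torus_dist_le_norm p(2) order_trans by blast
  have iso: "\<not> (torus_dist x y' \<le> r \<and> torus_dist x' y' \<le> r)" if "x' \<in> ?X" "x' \<noteq> x" "y' \<in> ?Y" for x' y'
    using x(2) that by (auto simp: isolated_def)
  \<comment> \<open>The position of \<open>x\<close> is known only up to
    \<open>\<delta> * r\<close>; removing this small ball about \<open>p\<close> keeps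
    \<open>x\<close> itself out of the regions claimed to be empty.\<close>
  have xball: "x' \<noteq> x" if "x' \<notin> torus_ball p (\<delta> * r)" for x' using that xp xt by (auto simp: torus_ball_def)
  show ?thesis
  proof (cases "\<exists>x'\<in>?X. x' \<noteq> x \<and> torus_dist x' x \<le> s * r")
    case False
    have "?X \<inter> (torus_ball p ((s - \<delta>) * r) - torus_ball p (\<delta> * r)) = {}"
    proof (rule ccontr)
      assume "\<not> ?thesis"
      then obtain x' where x': "x' \<in> ?X" "torus_dist x' p \<le> (s - \<delta>) * r" "x' \<noteq> x"
        using xball by (auto simp: torus_ball_def)
      have "torus_dist x' x \<le> (s - \<delta>) * r + \<delta> * r"
        using torus_dist_triangle[of x' x p] x'(2) xp torus_dist_commute[of p x] by simp
      then show False using False x' by (auto simp: algebra_simps)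
    qed
    then show ?thesis using p(1) by blast
  next
    case True
    then obtain x' where x': "x' \<in> ?X" "x' \<noteq> x" "torus_dist x' x \<le> s * r" by blast
    obtain u where u: "u \<in> N" "torus_dist x' (p + r *\<^sub>R u) \<le> 2 * \<delta> * r"
      using torus_dist_near_net[OF N r xp x'(3)] by blast
    obtain v where v: "v \<in> N'" "torus_dist y (p + r *\<^sub>R v) \<le> 2 * \<delta> * r"
      using torus_dist_near_net[OF N' r xp, of y] y(2) torus_dist_commute[of y x] by auto
    \<comment> \<open>Shrinking by \<open>2 * \<delta> * r\<close> compensates for the error in
      \<open>y\<close>: a vertex other than \<open>x\<close> in this ball would be within
      \<open>r\<close> of \<open>y\<close>, hence adjacent to \<open>x\<close>.\<close>
    have "?X \<inter> (torus_ball (p + r *\<^sub>R v) ((1 - 2 * \<delta>) * r) - torus_ball p (\<delta> * r)) = {}"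
    proof (rule ccontr)
      assume "\<not> ?thesis"
      then obtain w where w: "w \<in> ?X" "torus_dist w (p + r *\<^sub>R v) \<le> (1 - 2 * \<delta>) * r" "w \<noteq> x"
        using xball by (auto simp: torus_ball_def)
      have "torus_dist w y \<le> (1 - 2 * \<delta>) * r + 2 * \<delta> * r"
        using torus_dist_triangle[of w y "p + r *\<^sub>R v"] w(2) v(2) torus_dist_commute[of "p + r *\<^sub>R v" y] by simp
      then have "torus_dist w y \<le> r" by (simp add: algebra_simps)
      then show False using iso[OF w(1,3) y(1)] y(2) by blast
    qed
    \<comment> \<open>About \<open>p\<close> a loss of \<open>\<delta> * r\<close> would do; equal
      radii give a lens of the shape measured by \<open>eta\<close>.\<close>
    moreover have "?Y \<inter> (torus_ball p ((1 - 2 * \<delta>) * r) \<inter> torus_ball (p + r *\<^sub>R u) ((1 - 2 * \<delta>) * r)) = {}"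
    proof (rule ccontr)
      assume "\<not> ?thesis"
      then obtain w where w: "w \<in> ?Y" "torus_dist w p \<le> (1 - 2 * \<delta>) * r" "torus_dist w (p + r *\<^sub>R u) \<le> (1 - 2 * \<delta>) * r"
        by (auto simp: torus_ball_def)
      have "torus_dist x w \<le> \<delta> * r + (1 - 2 * \<delta>) * r"
        using torus_dist_triangle[of x w p] w(2) xp torus_dist_commute[of p w] by simp
      moreover have "0 \<le> \<delta> * r" using \<delta> r by simp
      ultimately have "torus_dist x w \<le> r" by (simp add: algebra_simps)
      moreover have "torus_dist x' w \<le> 2 * \<delta> * r + (1 - 2 * \<delta>) * r"
        using torus_dist_triangle[of x' w "p + r *\<^sub>R u"] w(3) u(2) torus_dist_commute[of "p + r *\<^sub>R u" w] by simp
      then have "torus_dist x' w \<le> r" by (simp add: algebra_simps)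
      ultimately show False using iso[OF x'(1,2) w(1)] by blast
    qed
    ultimately show ?thesis using p(1) u(1) v(1) by blast
  qed
qed

text \<open>Grid size times the cost at one position. The bound on \<open>max 1 s * r\<close> keeps
  ball volumes Euclidean. The bound on \<open>s\<close> compares offsets with the shrunken radius
  \<open>(1 - 2 * \<delta>) * r\<close>, so that every lens has at least the relative volume
  \<open>eta q\<close>. In the second case the two voids concern independent processes, and their
  probabilities multiply.\<close>

lemma prob_num_isolated_neq_vacant:
  fixes N N' :: "(real ^ 'n) set"
  assumes r: "0 < r" "max 1 s * r < 1 / 2" and \<delta>: "0 < \<delta>" "\<delta> < 1 / 2" "\<delta> \<le> s" "\<delta> * r \<le> 1"
    and N: "net s \<delta> N" and N': "net 1 \<delta> N'"
    and s: "s \<le> q powr (1 / real CARD('n)) * (1 - 2 * \<delta>)"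
  defines "t \<equiv> theta TYPE('n) * r ^ CARD('n)"
  shows "prob {\<omega> \<in> space M. num_isolated (P1 \<omega>) (P2 \<omega>) r \<noteq> card (P1 \<omega> \<inter> vacant (P2 \<omega>) r)} \<le>
    (3 * real CARD('n) / (\<delta> * r)) ^ CARD('n) *
     (exp (- (l1 * t * ((s - \<delta>) ^ CARD('n) - \<delta> ^ CARD('n)))) +
      real (card N) * real (card N') * exp (- (l1 * t * ((1 - 2 * \<delta>) ^ CARD('n) - \<delta> ^ CARD('n)) + l2 * t * ((1 - 2 * \<delta>) ^ CARD('n) * eta TYPE('n) q))))"
proof -
  let ?d = "CARD('n)"
  have dr: "0 < \<delta> * r" using \<delta> r by simp
  obtain G :: "(real ^ 'n) set" where G: "finite G" "real (card G) \<le> (3 * real ?d / (\<delta> * r)) ^ ?d"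
    "\<And>x. x \<in> torus \<Longrightarrow> \<exists>p\<in>G. norm (x - p) \<le> \<delta> * r"
    using torus_grid[OF dr \<delta>(4), where 'n = 'n] by blast
  have fin: "finite N" "finite N'" using N N' by (auto simp: net_def)
  let ?A = "\<lambda>p. torus_ball p ((s - \<delta>) * r) - torus_ball p (\<delta> * r)"
  let ?B = "\<lambda>p v. torus_ball (p + r *\<^sub>R v) ((1 - 2 * \<delta>) * r) - torus_ball p (\<delta> * r)"
  let ?C = "\<lambda>p u. torus_ball p ((1 - 2 * \<delta>) * r) \<inter> torus_ball (p + r *\<^sub>R u) ((1 - 2 * \<delta>) * r)"
  let ?E1 = "\<lambda>p. {\<omega> \<in> space M. P1 \<omega> \<inter> ?A p = {}}"
  let ?E2 = "\<lambda>p u v. {\<omega> \<in> space M. P1 \<omega> \<inter> ?B p v = {} \<and> P2 \<omega> \<inter> ?C p u = {}}"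
  let ?a = "exp (- (l1 * t * ((s - \<delta>) ^ ?d - \<delta> ^ ?d)))"
  let ?b = "exp (- (l1 * t * ((1 - 2 * \<delta>) ^ ?d - \<delta> ^ ?d) + l2 * t * ((1 - 2 * \<delta>) ^ ?d * eta TYPE('n) q)))"
  have E1: "?E1 p \<in> sets M" for p by (rule X.void_event) simp
  have E2: "?E2 p u v \<in> sets M" for p u v
  proof -
    have "?E2 p u v = {\<omega> \<in> space M. P1 \<omega> \<inter> ?B p v = {}} \<inter> {\<omega> \<in> space M. P2 \<omega> \<inter> ?C p u = {}}" by blast
    also have "\<dots> \<in> sets M" by (intro sets.Int X.void_event Y.void_event) simp_all
    finally show ?thesis .
  qed
  have E2': "(\<Union>u\<in>N. \<Union>v\<in>N'. ?E2 p u v) \<in> sets M" for p by (intro sets.finite_UN fin E2)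
  have small: "(s - \<delta>) * r < 1 / 2" "\<delta> * r < 1 / 2" "(1 - 2 * \<delta>) * r < 1 / 2"
  proof -
    have 1: "(s - \<delta>) * r \<le> max 1 s * r" "(1 - 2 * \<delta>) * r \<le> max 1 s * r" "\<delta> * r \<le> max 1 s * r"
      using r \<delta> by (intro mult_right_mono; simp)+
    show "(s - \<delta>) * r < 1 / 2" "\<delta> * r < 1 / 2" "(1 - 2 * \<delta>) * r < 1 / 2" using 1 r(2) by linarith+
  qed
  have p1: "prob (?E1 p) \<le> ?a" for p
  proof -
    have "prob (?E1 p) = exp (- (l1 * measure lborel (?A p)))"
      by (rule X.prob_void) (auto simp: torus_ball_def)
    moreover have "theta TYPE('n) * (((s - \<delta>) * r) ^ ?d - (\<delta> * r) ^ ?d) \<le> measure lborel (?A p)"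
      using small \<delta> r by (intro torus_ball_Diff_ge) auto
    then have "l1 * (theta TYPE('n) * (((s - \<delta>) * r) ^ ?d - (\<delta> * r) ^ ?d)) \<le> l1 * measure lborel (?A p)"
      using l1 by (intro mult_left_mono) auto
    moreover have "l1 * (theta TYPE('n) * (((s - \<delta>) * r) ^ ?d - (\<delta> * r) ^ ?d)) = l1 * t * ((s - \<delta>) ^ ?d - \<delta> ^ ?d)"
      unfolding power_mult_distrib t_def by (simp add: algebra_simps)
    ultimately show ?thesis by (simp only: exp_le_cancel_iff neg_le_iff_le)
  qed
  have p2: "prob (?E2 p u v) \<le> ?b" if "u \<in> N" for p u v
  proof -
    have pr: "prob (?E2 p u v) = exp (- (l1 * measure lborel (?B p v))) * exp (- (l2 * measure lborel (?C p u)))"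
      by (rule prob_void_void) (auto simp: torus_ball_def)
    have "theta TYPE('n) * (((1 - 2 * \<delta>) * r) ^ ?d - (\<delta> * r) ^ ?d) \<le> measure lborel (?B p v)"
      using small \<delta> r by (intro torus_ball_Diff_ge) auto
    then have "l1 * (theta TYPE('n) * (((1 - 2 * \<delta>) * r) ^ ?d - (\<delta> * r) ^ ?d)) \<le> l1 * measure lborel (?B p v)"
      using l1 by (intro mult_left_mono) auto
    moreover have "((1 - 2 * \<delta>) * r) ^ ?d * theta TYPE('n) * eta TYPE('n) q \<le> measure lborel (?C p u)"
    proof (rule torus_lens_ge)
      have "norm u \<le> s" using that N by (auto simp: net_def)
      then have "norm (r *\<^sub>R u) \<le> r * s" using r by simp
      also have "\<dots> \<le> r * (q powr (1 / real ?d) * (1 - 2 * \<delta>))" using s r by (intro mult_left_mono) auto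
      finally show "norm (r *\<^sub>R u) \<le> q powr (1 / real ?d) * ((1 - 2 * \<delta>) * r)" by (simp add: algebra_simps)
    qed (use small \<delta> r in auto)
    then have "l2 * (((1 - 2 * \<delta>) * r) ^ ?d * theta TYPE('n) * eta TYPE('n) q) \<le> l2 * measure lborel (?C p u)"
      using l2 by (intro mult_left_mono) auto
    moreover have "l1 * (theta TYPE('n) * (((1 - 2 * \<delta>) * r) ^ ?d - (\<delta> * r) ^ ?d)) = l1 * t * ((1 - 2 * \<delta>) ^ ?d - \<delta> ^ ?d)"
      "l2 * (((1 - 2 * \<delta>) * r) ^ ?d * theta TYPE('n) * eta TYPE('n) q) = l2 * t * ((1 - 2 * \<delta>) ^ ?d * eta TYPE('n) q)"
      unfolding power_mult_distrib t_def by (simp_all add: algebra_simps)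
    ultimately have "- (l1 * measure lborel (?B p v)) + - (l2 * measure lborel (?C p u)) \<le>
      - (l1 * t * ((1 - 2 * \<delta>) ^ ?d - \<delta> ^ ?d) + l2 * t * ((1 - 2 * \<delta>) ^ ?d * eta TYPE('n) q))"
      by linarith
    then show ?thesis unfolding pr exp_add[symmetric] by (simp only: exp_le_cancel_iff)
  qed
  let ?F = "\<lambda>p. ?E1 p \<union> (\<Union>u\<in>N. \<Union>v\<in>N'. ?E2 p u v)"
  have pU: "prob (\<Union>u\<in>N. \<Union>v\<in>N'. ?E2 p u v) \<le> real (card N) * (real (card N') * ?b)" for p
  proof -
    have "prob (\<Union>u\<in>N. \<Union>v\<in>N'. ?E2 p u v) \<le> (\<Sum>u\<in>N. prob (\<Union>v\<in>N'. ?E2 p u v))"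
      by (intro measure_UNION_le fin sets.finite_UN E2)
    also have "\<dots> \<le> (\<Sum>u\<in>N. real (card N') * ?b)"
    proof (rule sum_mono)
      fix u assume u: "u \<in> N"
      have "prob (\<Union>v\<in>N'. ?E2 p u v) \<le> (\<Sum>v\<in>N'. prob (?E2 p u v))"
        by (intro measure_UNION_le fin E2)
      also have "\<dots> \<le> (\<Sum>v\<in>N'. ?b)" by (intro sum_mono p2 u)
      finally show "prob (\<Union>v\<in>N'. ?E2 p u v) \<le> real (card N') * ?b" by simp
    qed
    finally show ?thesis by simp
  qed
  have pF: "prob (?F p) \<le> ?a + real (card N) * real (card N') * ?b" for p
  proof -
    have "prob (?F p) \<le> prob (?E1 p) + prob (\<Union>u\<in>N. \<Union>v\<in>N'. ?E2 p u v)"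
      by (rule measure_Un_le[OF E1 E2'])
    also have "\<dots> \<le> ?a + real (card N) * (real (card N') * ?b)" by (rule add_mono[OF p1 pU])
    finally show ?thesis by (simp only: mult.assoc)
  qed
  have "prob {\<omega> \<in> space M. num_isolated (P1 \<omega>) (P2 \<omega>) r \<noteq> card (P1 \<omega> \<inter> vacant (P2 \<omega>) r)} \<le> prob (\<Union>p\<in>G. ?F p)"
  proof (rule X.finite_measure_mono)
    show "{\<omega> \<in> space M. num_isolated (P1 \<omega>) (P2 \<omega>) r \<noteq> card (P1 \<omega> \<inter> vacant (P2 \<omega>) r)} \<subseteq> (\<Union>p\<in>G. ?F p)"
    proof safe
      fix \<omega> assume "\<omega> \<in> space M" "num_isolated (P1 \<omega>) (P2 \<omega>) r \<noteq> card (P1 \<omega> \<inter> vacant (P2 \<omega>) r)"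
      from num_isolated_bad_cases[OF this(1) r(1) \<delta>(1) G(3) N N' this(2)] this(1)
      show "\<omega> \<in> (\<Union>p\<in>G. ?F p)" by blast
    qed
    show "(\<Union>p\<in>G. ?F p) \<in> X.events" by (intro sets.finite_UN G sets.Un E1 E2')
  qed
  also have "\<dots> \<le> (\<Sum>p\<in>G. prob (?F p))" by (intro measure_UNION_le G sets.Un E1 E2')
  also have "\<dots> \<le> (\<Sum>p\<in>G. ?a + real (card N) * real (card N') * ?b)" by (intro sum_mono pF)
  also have "\<dots> = real (card G) * (?a + real (card N) * real (card N') * ?b)" by simp
  also have "\<dots> \<le> (3 * real ?d / (\<delta> * r)) ^ ?d * (?a + real (card N) * real (card N') * ?b)"
    by (intro mult_right_mono G) simp
  finally show ?thesis .
qed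

lemma vacant_count_measurable: "(\<lambda>\<omega>. card (P1 \<omega> \<inter> vacant (P2 \<omega>) r)) \<in> measurable M (count_space UNIV)"
  using measurable_card_section[OF X.measurable_P pred_vacant[OF Y.measurable_P, of r]] by simp

lemma prob_num_isolated_diff_le:
  "\<bar>prob {\<omega> \<in> space M. num_isolated (P1 \<omega>) (P2 \<omega>) r = k} - prob {\<omega> \<in> space M. card (P1 \<omega> \<inter> vacant (P2 \<omega>) r) = k}\<bar>
   \<le> prob {\<omega> \<in> space M. num_isolated (P1 \<omega>) (P2 \<omega>) r \<noteq> card (P1 \<omega> \<inter> vacant (P2 \<omega>) r)}"
proof -
  let ?W = "\<lambda>\<omega>. num_isolated (P1 \<omega>) (P2 \<omega>) r" and ?W' = "\<lambda>\<omega>. card (P1 \<omega> \<inter> vacant (P2 \<omega>) r)"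
  have [measurable]: "(\<lambda>\<omega>. real (?W \<omega>)) \<in> borel_measurable M" "(\<lambda>\<omega>. real (?W' \<omega>)) \<in> borel_measurable M"
    by (rule measurable_compose[OF measurable_num_isolated[OF X.measurable_P Y.measurable_P]], simp)
      (rule measurable_compose[OF vacant_count_measurable], simp)
  have "{\<omega> \<in> space M. real (?W \<omega>) \<noteq> real (?W' \<omega>)} \<in> sets M"
    "{\<omega> \<in> space M. real (?W \<omega>) = real k} \<in> sets M" "{\<omega> \<in> space M. real (?W' \<omega>) = real k} \<in> sets M"
    by measurable
  then have D: "{\<omega> \<in> space M. ?W \<omega> \<noteq> ?W' \<omega>} \<in> sets M"
    and A: "{\<omega> \<in> space M. ?W \<omega> = k} \<in> sets M" "{\<omega> \<in> space M. ?W' \<omega> = k} \<in> sets M"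
    by simp_all
  have "prob {\<omega> \<in> space M. ?W \<omega> = k} \<le> prob ({\<omega> \<in> space M. ?W' \<omega> = k} \<union> {\<omega> \<in> space M. ?W \<omega> \<noteq> ?W' \<omega>})"
    using A D by (intro X.finite_measure_mono sets.Un) auto
  also have "\<dots> \<le> prob {\<omega> \<in> space M. ?W' \<omega> = k} + prob {\<omega> \<in> space M. ?W \<omega> \<noteq> ?W' \<omega>}"
    by (rule measure_Un_le[OF A(2) D])
  finally have 1: "prob {\<omega> \<in> space M. ?W \<omega> = k} \<le> \<dots>" .
  have "prob {\<omega> \<in> space M. ?W' \<omega> = k} \<le> prob ({\<omega> \<in> space M. ?W \<omega> = k} \<union> {\<omega> \<in> space M. ?W \<omega> \<noteq> ?W' \<omega>})"
    using A D by (intro X.finite_measure_mono sets.Un) auto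
  also have "\<dots> \<le> prob {\<omega> \<in> space M. ?W \<omega> = k} + prob {\<omega> \<in> space M. ?W \<omega> \<noteq> ?W' \<omega>}"
    by (rule measure_Un_le[OF A(1) D])
  finally show ?thesis using 1 by linarith
qed

end

section \<open>Asymptotics\<close>

text \<open>The distribution function at \<open>x\<close> is a finite sum of point masses, so it
  converges at every \<open>x\<close>, not only where the limit is continuous.\<close>

lemma weak_conv_m_natI:
  fixes W :: "nat \<Rightarrow> 'w \<Rightarrow> nat" and p :: "nat pmf"
  assumes M: "\<And>n. n > 0 \<Longrightarrow> prob_space (M n)"
    and W: "\<And>n. n > 0 \<Longrightarrow> W n \<in> measurable (M n) (count_space UNIV)"
    and lim: "\<And>k. (\<lambda>n. measure (M n) {\<omega> \<in> space (M n). W n \<omega> = k}) \<longlonglongrightarrow> pmf p k"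
  shows "weak_conv_m (\<lambda>n. distr (M n) borel (\<lambda>\<omega>. real (W n \<omega>))) (distr (measure_pmf p) borel real)"
  unfolding weak_conv_m_def weak_conv_def
proof (intro allI impI)
  fix x :: real
  let ?K = "{k. real k \<le> x}"
  have "?K \<subseteq> {..nat \<lceil>x\<rceil>}" by (auto simp: le_nat_iff) linarith
  then have fin: "finite ?K" by (rule finite_subset) simp
  have "cdf (distr (measure_pmf p) borel real) x = measure (measure_pmf p) ?K"
    unfolding cdf_def by (subst measure_distr) (auto simp: vimage_def)
  also have "\<dots> = (\<Sum>k\<in>?K. pmf p k)" by (rule measure_measure_pmf_finite[OF fin])
  finally have p: "cdf (distr (measure_pmf p) borel real) x = (\<Sum>k\<in>?K. pmf p k)" .
  have "cdf (distr (M n) borel (\<lambda>\<omega>. real (W n \<omega>))) x = (\<Sum>k\<in>?K. measure (M n) {\<omega> \<in> space (M n). W n \<omega> = k})"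
    if "n > 0" for n
  proof -
    interpret prob_space "M n" by (rule M[OF that])
    note [measurable] = W[OF that]
    have "cdf (distr (M n) borel (\<lambda>\<omega>. real (W n \<omega>))) x = prob ((\<lambda>\<omega>. real (W n \<omega>)) -` {..x} \<inter> space (M n))"
      unfolding cdf_def by (subst measure_distr) auto
    also have "(\<lambda>\<omega>. real (W n \<omega>)) -` {..x} \<inter> space (M n) = (\<Union>k\<in>?K. {\<omega> \<in> space (M n). W n \<omega> = k})" by auto
    also have "prob \<dots> = (\<Sum>k\<in>?K. prob {\<omega> \<in> space (M n). W n \<omega> = k})"
      by (rule finite_measure_finite_Union[OF fin]) (auto simp: disjoint_family_on_def)
    finally show ?thesis .
  qed
  then have ev: "eventually (\<lambda>n. (\<Sum>k\<in>?K. measure (M n) {\<omega> \<in> space (M n). W n \<omega> = k}) =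
      cdf (distr (M n) borel (\<lambda>\<omega>. real (W n \<omega>))) x) sequentially"
    by (intro eventually_mono[OF eventually_gt_at_top[of 0]]) auto
  have "(\<lambda>n. \<Sum>k\<in>?K. measure (M n) {\<omega> \<in> space (M n). W n \<omega> = k}) \<longlonglongrightarrow> (\<Sum>k\<in>?K. pmf p k)"
    by (intro tendsto_sum lim)
  then show "(\<lambda>n. cdf (distr (M n) borel (\<lambda>\<omega>. real (W n \<omega>))) x) \<longlonglongrightarrow> cdf (distr (measure_pmf p) borel real) x"
    unfolding p by (rule Lim_transform_eventually[OF _ ev])
qed

text \<open>In dimension 2 the supremum provides \<open>q > c\<close> with
  \<open>eta q + 1 / q > 1\<close>, and \<open>1 / c\<close> is larger than \<open>1 / q\<close>.
  Otherwise \<open>1 / c > 1\<close> already, and any \<open>q > c\<close> will do.\<close>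

lemma below_c0:
  assumes dim: "CARD('n::finite) \<ge> 2" and c: "0 < c" "c < c0 TYPE('n)"
  shows "\<exists>q>c. eta TYPE('n) q + 1 / c > 1"
proof (cases "CARD('n) = 2")
  case False
  then have "c < 1" using c by (simp add: c0_def)
  then have "1 / c > 1" using c by simp
  then have "eta TYPE('n) (c + 1) + 1 / c > 1" using eta_nonneg[where 'n = 'n, of "c + 1"] by linarith
  then show ?thesis by (intro exI[of _ "c + 1"]) auto
next
  case True
  let ?S = "{c. c > 0 \<and> eta TYPE('n) c + 1 / c > 1}"
  \<comment> \<open>For \<open>s > 4\<close> the centres are more than 2 apart. This bounds the set,
    without which its real \<open>Sup\<close> would carry no information.\<close>
  have eta0: "eta TYPE('n) s = 0" if "s > 4" for s
  proof -
    have "s powr (1 / real CARD('n)) = sqrt s" using that True by (simp add: powr_half_sqrt)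
    moreover have "sqrt s > sqrt 4" using that by (simp only: real_sqrt_less_iff)
    ultimately have n: "norm (s powr (1 / real CARD('n)) *\<^sub>R e1 :: real ^ 'n) > 2" using that by (simp add: e1_def)
    have "cball 0 1 \<inter> cball (s powr (1 / real CARD('n)) *\<^sub>R e1 :: real ^ 'n) 1 = {}"
    proof (rule ccontr)
      assume "cball 0 1 \<inter> cball (s powr (1 / real CARD('n)) *\<^sub>R e1 :: real ^ 'n) 1 \<noteq> {}"
      then obtain w where "norm w \<le> 1" "dist (s powr (1 / real CARD('n)) *\<^sub>R e1 :: real ^ 'n) w \<le> 1" by auto
      then show False using n norm_triangle_sub[of "s powr (1 / real CARD('n)) *\<^sub>R e1 :: real ^ 'n" w] by (simp add: dist_norm)
    qed
    then show ?thesis by (simp add: eta_def)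
  qed
  have "bdd_above ?S"
  proof (rule bdd_aboveI[of _ 4])
    fix s assume s: "s \<in> ?S"
    show "s \<le> 4"
    proof (rule ccontr)
      assume "\<not> s \<le> 4"
      then have "eta TYPE('n) s = 0" "1 / s < 1" using eta0 by auto
      with s show False by simp
    qed
  qed
  moreover have "1 / 2 \<in> ?S" using eta_nonneg[where 'n = 'n, of "1 / 2"] by simp
  then have "?S \<noteq> {}" by blast
  ultimately obtain q where q: "q \<in> ?S" "c < q" using c True less_cSup_iff[of ?S c] by (auto simp: c0_def)
  then have "1 / q < 1 / c" using c by (intro divide_strict_left_mono) auto
  with q show ?thesis by (intro exI[of _ q]) auto
qed

text \<open>As \<open>\<delta>\<close> tends to 0 with
  \<open>s = q powr (1 / d) * (1 - 2 * \<delta>)\<close>, the two exponents tend to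
  \<open>q / c\<close> and \<open>1 / c + e\<close>, both above 1; by continuity small
  \<open>\<delta>\<close> works.\<close>

lemma choose_parameters:
  fixes d :: nat and c q e :: real
  assumes d: "d > 0" and c: "0 < c" "c < q" and e: "e + 1 / c > 1"
  shows "\<exists>\<delta> s. 0 < \<delta> \<and> \<delta> < 1 / 2 \<and> \<delta> \<le> s \<and> s \<le> q powr (1 / real d) * (1 - 2 * \<delta>) \<and>
    ((s - \<delta>) ^ d - \<delta> ^ d) / c > 1 \<and> ((1 - 2 * \<delta>) ^ d - \<delta> ^ d) / c + (1 - 2 * \<delta>) ^ d * e > 1"
proof -
  let ?t = "q powr (1 / real d)"
  let ?s = "\<lambda>\<delta>. ?t * (1 - 2 * \<delta>)"
  have t: "?t ^ d = q" "?t > 0" using d c by (auto simp: powr_powr simp flip: powr_realpow)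
  have 1: "((\<lambda>\<delta>. ((?s \<delta> - \<delta>) ^ d - \<delta> ^ d) / c) \<longlongrightarrow> ((?t * (1 - 2 * 0) - 0) ^ d - 0 ^ d) / c) (at_right 0)"
    using c by (intro tendsto_intros) auto
  have 2: "((\<lambda>\<delta>. ((1 - 2 * \<delta>) ^ d - \<delta> ^ d) / c + (1 - 2 * \<delta>) ^ d * e) \<longlongrightarrow> ((1 - 2 * 0) ^ d - 0 ^ d) / c + (1 - 2 * 0) ^ d * e) (at_right 0)"
    using c by (intro tendsto_intros) auto
  have 3: "((\<lambda>\<delta>. ?s \<delta> - \<delta>) \<longlongrightarrow> ?t * (1 - 2 * 0) - 0) (at_right 0)"
    by (intro tendsto_intros)
  have "eventually (\<lambda>\<delta>. ((?s \<delta> - \<delta>) ^ d - \<delta> ^ d) / c > 1) (at_right 0)"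
    using c d t by (intro order_tendstoD(1)[OF 1]) (simp add: power_0_left)
  moreover have "eventually (\<lambda>\<delta>. ((1 - 2 * \<delta>) ^ d - \<delta> ^ d) / c + (1 - 2 * \<delta>) ^ d * e > 1) (at_right 0)"
    using e d by (intro order_tendstoD(1)[OF 2]) (simp add: power_0_left)
  moreover have "eventually (\<lambda>\<delta>. ?s \<delta> - \<delta> > 0) (at_right 0)"
    using t by (intro order_tendstoD(1)[OF 3]) simp
  moreover have "eventually (\<lambda>\<delta> :: real. \<delta> > 0 \<and> \<delta> < 1 / 2) (at_right 0)"
    unfolding eventually_at_right_field by (intro exI[of _ "1 / 2"]) auto
  ultimately have "eventually (\<lambda>\<delta>. 0 < \<delta> \<and> \<delta> < 1 / 2 \<and> ?s \<delta> - \<delta> > 0 \<and> ((?s \<delta> - \<delta>) ^ d - \<delta> ^ d) / c > 1 \<and>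
     ((1 - 2 * \<delta>) ^ d - \<delta> ^ d) / c + (1 - 2 * \<delta>) ^ d * e > 1) (at_right 0)"
    by eventually_elim auto
  then obtain \<delta> where "0 < \<delta> \<and> \<delta> < 1 / 2 \<and> ?s \<delta> - \<delta> > 0 \<and> ((?s \<delta> - \<delta>) ^ d - \<delta> ^ d) / c > 1 \<and>
     ((1 - 2 * \<delta>) ^ d - \<delta> ^ d) / c + (1 - 2 * \<delta>) ^ d * e > 1"
    using eventually_happens[of _ "at_right (0 :: real)"] by (auto simp: trivial_limit_at_right_real)
  then show ?thesis by (intro exI[of _ \<delta>] exI[of _ "?s \<delta>"]) auto
qed

text \<open>The cut-off \<open>\<rho> = L powr (- 3 / 4)\<close> makes both \<open>L \<rho>\<^sup>2\<close> and \<open>L exp (- (L \<rho> / 4))\<close> vanish; this is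
  where dimension at least 2 enters.\<close>

lemma variance_error_tendsto:
  fixes K C :: real
  assumes "K > 0" "C > 0"
  shows "((\<lambda>L. sqrt (C * L * ((L powr (- 3 / 4)) ^ 2 + K * exp (- (L * L powr (- 3 / 4) / 4))))) \<longlongrightarrow> 0) at_top"
  using assms by real_asymp

text \<open>\<open>exp L / L\<close> is the order of the number of grid positions; exponents above 1
  outweigh it.\<close>

lemma isolation_error_tendsto:
  fixes K C a b :: real
  assumes "K > 0" "C > 0" "a > 1" "b > 1"
  shows "((\<lambda>L. C * exp L / L * (exp (- (L * a)) + K * exp (- (L * b)))) \<longlongrightarrow> 0) at_top"
proof -
  have *: "((\<lambda>L. A / L * exp (- (L * x))) \<longlongrightarrow> 0) at_top" if "A > 0" "x > 0" for A x :: real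
    using that by real_asymp
  have "((\<lambda>L. C / L * exp (- (L * (a - 1))) + C * K / L * exp (- (L * (b - 1)))) \<longlongrightarrow> 0 + 0) at_top"
    using assms by (intro tendsto_add *) auto
  moreover have "C / L * exp (- (L * (a - 1))) + C * K / L * exp (- (L * (b - 1)))
      = C * exp L / L * (exp (- (L * a)) + K * exp (- (L * b)))" for L
  proof -
    have e: "exp (- (L * (y - 1))) = exp L * exp (- (L * y))" for y
      by (simp add: algebra_simps flip: exp_add)
    show ?thesis unfolding e by (simp add: algebra_simps)
  qed
  ultimately show ?thesis by simp
qed

section \<open>The logarithmic scale of the radius\<close>

lemma log_at_top:
  assumes "\<beta> > 0"
  shows "filterlim (\<lambda>n. ln (real n / \<beta>)) at_top sequentially"
  using assms by real_asymp

lemma conn_radius_tendsto_0: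
  assumes "\<beta> > 0" "c > 0"
  shows "conn_radius TYPE('n::finite) c \<beta> \<longlonglongrightarrow> 0"
proof -
  define t where "t = theta TYPE('n)"
  define e where "e = 1 / real CARD('n)"
  have "t > 0" "e > 0" using theta_pos[where 'n = 'n] by (auto simp: t_def e_def)
  then have "(\<lambda>n. (ln (real n / \<beta>) / (c * real n * t)) powr e) \<longlonglongrightarrow> 0"
    using assms by real_asymp
  then show ?thesis by (simp add: conn_radius_def[abs_def] t_def e_def)
qed

lemma conn_radius_power:
  assumes "c > 0" "n > 0" "ln (real n / \<beta>) > 0"
  shows "conn_radius TYPE('n::finite) c \<beta> n > 0"
    and "theta TYPE('n) * conn_radius TYPE('n) c \<beta> n ^ CARD('n) = ln (real n / \<beta>) / (c * real n)"
proof -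
  have x: "ln (real n / \<beta>) / (c * real n * theta TYPE('n)) > 0"
    using assms theta_pos[where 'n = 'n] by simp
  show "conn_radius TYPE('n) c \<beta> n > 0"
    unfolding conn_radius_def powr_gt_zero using less_imp_neq[OF x] by (rule not_sym)
  have "(y powr (1 / real CARD('n))) ^ CARD('n) = y" if "y > 0" for y :: real
    using that by (simp add: powr_powr flip: powr_realpow)
  from this[OF x] have "conn_radius TYPE('n) c \<beta> n ^ CARD('n) = ln (real n / \<beta>) / (c * real n * theta TYPE('n))"
    by (simp only: conn_radius_def)
  then show "theta TYPE('n) * conn_radius TYPE('n) c \<beta> n ^ CARD('n) = ln (real n / \<beta>) / (c * real n)"
    using theta_pos[where 'n = 'n] by simp
qed

theorem theorem3p5:
  fixes M :: "nat \<Rightarrow> 'w measure"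
    and P1 P2 :: "nat \<Rightarrow> 'w \<Rightarrow> (real ^ 'n) set"
    and c \<beta> :: real
  assumes dim: "CARD('n) \<ge> 2"
    and beta: "\<beta> > 0"
    and c: "0 < c" "c < c0 TYPE('n)"
    and prob: "\<And>n. n > 0 \<Longrightarrow> prob_space (M n)"
    and P1: "\<And>n. n > 0 \<Longrightarrow> poisson_process (M n) (real n) (P1 n)"
    and P2: "\<And>n. n > 0 \<Longrightarrow> poisson_process (M n) (c * real n) (P2 n)"
    and indep: "\<And>n. n > 0 \<Longrightarrow>
      prob_space.indep_var (M n) config_space (P1 n) config_space (P2 n)"
  shows "weak_conv_m
           (\<lambda>n. distr (M n) borel
              (\<lambda>\<omega>. real (num_isolated (P1 n \<omega>) (P2 n \<omega>) (conn_radius TYPE('n) c \<beta> n))))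
           (distr (measure_pmf (poisson_pmf \<beta>)) borel real)
       \<and> (\<lambda>n. measure (M n) {\<omega> \<in> space (M n).
            largest_nn_radius (P1 n \<omega>) (P2 n \<omega>) \<le> ennreal (conn_radius TYPE('n) c \<beta> n)})
         \<longlonglongrightarrow> exp (- \<beta>)"
proof -
  let ?d = "CARD('n)" and ?\<theta> = "theta TYPE('n)"
  define r where "r = conn_radius TYPE('n) c \<beta>"
  define L where "L = (\<lambda>n. ln (real n / \<beta>))"
  define W where "W = (\<lambda>n \<omega>. num_isolated (P1 n \<omega>) (P2 n \<omega>) (r n))"
  have graph: "ab_graph (M n) (P1 n) (P2 n) (real n) (c * real n)" if "n > 0" for n
    using that prob P1 P2 indep c
    by (intro ab_graph.intro poisson_space.intro poisson_space_axioms.intro ab_graph_axioms.intro) auto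
  obtain q where q: "q > c" "eta TYPE('n) q + 1 / c > 1" using below_c0[OF dim c] by blast
  obtain \<delta> s where \<delta>: "0 < \<delta>" "\<delta> < 1 / 2" "\<delta> \<le> s" "s \<le> q powr (1 / real ?d) * (1 - 2 * \<delta>)"
    and a: "((s - \<delta>) ^ ?d - \<delta> ^ ?d) / c > 1"
    and b: "((1 - 2 * \<delta>) ^ ?d - \<delta> ^ ?d) / c + (1 - 2 * \<delta>) ^ ?d * eta TYPE('n) q > 1"
    using choose_parameters[of ?d c q "eta TYPE('n) q"] c q by auto
  let ?a = "((s - \<delta>) ^ ?d - \<delta> ^ ?d) / c"
  let ?b = "((1 - 2 * \<delta>) ^ ?d - \<delta> ^ ?d) / c + (1 - 2 * \<delta>) ^ ?d * eta TYPE('n) q"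
  obtain N N' :: "(real ^ 'n) set" where N: "net s \<delta> N" and N': "net 1 \<delta> N'"
    using net_exists[OF \<delta>(1)] by metis
  \<comment> \<open>The added 1 makes \<open>K\<close> positive without inspecting the nets.\<close>
  define K where "K = real (card N) * real (card N') + 1"
  \<comment> \<open>From the grid size, on substituting
    \<open>r ^ d = L / (c * n * ?\<theta>)\<close> and \<open>n = \<beta> * exp L\<close>.\<close>
  define C where "C = (3 * real ?d / \<delta>) ^ ?d * c * ?\<theta> * \<beta>"
  have KC: "K > 0" "C > 0" using \<delta> c beta theta_pos[where 'n = 'n] by (auto simp: K_def C_def add_nonneg_pos)
  \<comment> \<open>\<open>\<beta> / c * L\<close> is \<open>n ^ 2\<close> times
    \<open>exp (- L) * ?\<theta> * r ^ d\<close>.\<close>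
  define E1 where "E1 = (\<lambda>L :: real. sqrt (\<beta> / c * L * ((L powr (- 3 / 4)) ^ 2 + 2 ^ ?d * exp (- (L * L powr (- 3 / 4) / 4)))))"
  define E2 where "E2 = (\<lambda>L :: real. C * exp L / L * (exp (- (L * ?a)) + K * exp (- (L * ?b))))"
  have L: "filterlim L at_top sequentially" unfolding L_def by (rule log_at_top[OF beta])
  have E1: "(\<lambda>n. E1 (L n)) \<longlonglongrightarrow> 0"
    unfolding E1_def using beta c by (intro filterlim_compose[OF variance_error_tendsto L]) auto
  have E2: "(\<lambda>n. E2 (L n)) \<longlonglongrightarrow> 0"
    unfolding E2_def using a b KC by (intro filterlim_compose[OF isolation_error_tendsto L]) auto
  have r0: "r \<longlonglongrightarrow> 0" unfolding r_def by (rule conn_radius_tendsto_0[OF beta c(1)])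
  have bound: "\<bar>measure (M n) {\<omega> \<in> space (M n). W n \<omega> = k} - pois k \<beta>\<bar> \<le> E1 (L n) + E2 (L n)"
    if n: "n > 0" and Ln: "L n \<ge> 1" and rn: "r n < 1 / 6" "r n < 1 / (2 * max 1 s)" "r n < 1 / \<delta>" for n k
  proof -
    interpret ab_graph "M n" "P1 n" "P2 n" "real n" "c * real n" by (rule graph[OF n])
    have rpos: "r n > 0" and t: "?\<theta> * r n ^ ?d = L n / (c * real n)"
      using conn_radius_power[where 'n = 'n, of c n \<beta>] c n Ln by (auto simp: r_def L_def)
    \<comment> \<open>Thus \<open>n * exp (- L n) = \<beta>\<close>: the expected number of vacant
      vertices equals the limiting mean, not merely asymptotically.\<close>
    have eL: "exp (- L n) = \<beta> / real n" "exp (L n) = real n / \<beta>"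
      using n beta by (simp_all add: L_def exp_minus)
    have m: "c * real n * (?\<theta> * r n ^ ?d) = L n" using c n by (simp add: t)
    define \<rho> where "\<rho> = L n powr (- 3 / 4)"
    have \<rho>: "0 < \<rho>" "\<rho> \<le> 1" using Ln powr_mono2'[of "- 3 / 4" 1 "L n"] by (auto simp: \<rho>_def)
    have "\<bar>prob {\<omega> \<in> space (M n). card (P1 n \<omega> \<inter> vacant (P2 n \<omega>) (r n)) = k} - pois k (real n * exp (- L n))\<bar> \<le>
      real n * sqrt (exp (- L n) * ?\<theta> * r n ^ ?d * (\<rho> ^ ?d + 2 ^ ?d * exp (- (L n * \<rho> / 4))))"
      using prob_card_vacant_bound[of "r n" \<rho> k] rpos rn \<rho> unfolding m by simp
    also have "\<dots> = sqrt ((real n)\<^sup>2 * (exp (- L n) * (?\<theta> * r n ^ ?d) * (\<rho> ^ ?d + 2 ^ ?d * exp (- (L n * \<rho> / 4)))))"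
      by (simp add: real_sqrt_mult mult.assoc)
    also have "(real n)\<^sup>2 * (exp (- L n) * (?\<theta> * r n ^ ?d) * (\<rho> ^ ?d + 2 ^ ?d * exp (- (L n * \<rho> / 4))))
      = \<beta> / c * L n * (\<rho> ^ ?d + 2 ^ ?d * exp (- (L n * \<rho> / 4)))"
      unfolding t eL using n c by (simp add: field_simps power2_eq_square)
    also have "sqrt \<dots> \<le> E1 (L n)"
    proof -
      have "\<rho> ^ ?d \<le> \<rho> ^ 2" using \<rho> dim by (intro power_decreasing) auto
      then show ?thesis unfolding E1_def \<rho>_def[symmetric] using beta c Ln
        by (intro real_sqrt_le_mono mult_left_mono add_right_mono) auto
    qed
    finally have 1: "\<bar>prob {\<omega> \<in> space (M n). card (P1 n \<omega> \<inter> vacant (P2 n \<omega>) (r n)) = k} - pois k \<beta>\<bar> \<le> E1 (L n)"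
      using n by (simp add: eL)
    have small: "max 1 s * r n < 1 / 2" "\<delta> * r n \<le> 1"
    proof -
      have "max 1 s > 0" by simp
      then show "max 1 s * r n < 1 / 2" using rn(2) by (simp add: field_simps)
      show "\<delta> * r n \<le> 1" using rn(3) \<delta> by (simp add: field_simps)
    qed
    have "prob {\<omega> \<in> space (M n). W n \<omega> \<noteq> card (P1 n \<omega> \<inter> vacant (P2 n \<omega>) (r n))} \<le>
      (3 * real ?d / (\<delta> * r n)) ^ ?d *
       (exp (- (real n * (?\<theta> * r n ^ ?d) * ((s - \<delta>) ^ ?d - \<delta> ^ ?d))) +
        real (card N) * real (card N') * exp (- (real n * (?\<theta> * r n ^ ?d) * ((1 - 2 * \<delta>) ^ ?d - \<delta> ^ ?d)
          + c * real n * (?\<theta> * r n ^ ?d) * ((1 - 2 * \<delta>) ^ ?d * eta TYPE('n) q))))"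
      unfolding W_def by (rule prob_num_isolated_neq_vacant[OF rpos small(1) \<delta>(1-3) small(2) N N' \<delta>(4)])
    also have "real n * (?\<theta> * r n ^ ?d) * ((s - \<delta>) ^ ?d - \<delta> ^ ?d) = L n * ?a"
      unfolding t using n by simp
    also have "real n * (?\<theta> * r n ^ ?d) * ((1 - 2 * \<delta>) ^ ?d - \<delta> ^ ?d)
          + c * real n * (?\<theta> * r n ^ ?d) * ((1 - 2 * \<delta>) ^ ?d * eta TYPE('n) q) = L n * ?b"
      unfolding m unfolding t using n by (simp add: distrib_left)
    also have "(3 * real ?d / (\<delta> * r n)) ^ ?d = C * exp (L n) / L n"
    proof -
      have "r n ^ ?d = ?\<theta> * r n ^ ?d / ?\<theta>" using theta_pos[where 'n = 'n] by simp
      then have "r n ^ ?d = L n / (c * real n) / ?\<theta>" by (simp only: t)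
      then show ?thesis
        using n c beta Ln \<delta> theta_pos[where 'n = 'n] unfolding C_def eL
        by (simp add: power_divide power_mult_distrib)
    qed
    also have "C * exp (L n) / L n * (exp (- (L n * ?a)) + real (card N) * real (card N') * exp (- (L n * ?b))) \<le> E2 (L n)"
      unfolding E2_def K_def using KC Ln by (intro mult_left_mono add_left_mono mult_right_mono) auto
    finally have 2: "prob {\<omega> \<in> space (M n). W n \<omega> \<noteq> card (P1 n \<omega> \<inter> vacant (P2 n \<omega>) (r n))} \<le> E2 (L n)" .
    show ?thesis using 1 2 prob_num_isolated_diff_le[of "r n" k] unfolding W_def by linarith
  qed
  have lim: "(\<lambda>n. measure (M n) {\<omega> \<in> space (M n). W n \<omega> = k}) \<longlonglongrightarrow> pois k \<beta>" for k
  proof -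
    have pos: "0 < 1 / (2 * max 1 s)" "0 < 1 / \<delta>" using \<delta> by auto
    have "eventually (\<lambda>n. n > 0 \<and> L n \<ge> 1 \<and> r n < 1 / 6 \<and> r n < 1 / (2 * max 1 s) \<and> r n < 1 / \<delta>) sequentially"
      using L pos by (intro eventually_conj eventually_gt_at_top order_tendstoD(2)[OF r0]) (auto simp: filterlim_at_top)
    then have "eventually (\<lambda>n. norm (measure (M n) {\<omega> \<in> space (M n). W n \<omega> = k} - pois k \<beta>) \<le> E1 (L n) + E2 (L n)) sequentially"
      by eventually_elim (use bound in auto)
    moreover have "(\<lambda>n. E1 (L n) + E2 (L n)) \<longlonglongrightarrow> 0" using tendsto_add[OF E1 E2] by simp
    ultimately have "(\<lambda>n. measure (M n) {\<omega> \<in> space (M n). W n \<omega> = k} - pois k \<beta>) \<longlonglongrightarrow> 0"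
      by (rule Lim_null_comparison)
    then show ?thesis by (rule LIM_zero_cancel)
  qed
  have "weak_conv_m (\<lambda>n. distr (M n) borel (\<lambda>\<omega>. real (W n \<omega>))) (distr (measure_pmf (poisson_pmf \<beta>)) borel real)"
  proof (rule weak_conv_m_natI)
    fix n :: nat assume n: "n > 0"
    show "prob_space (M n)" by (rule prob[OF n])
    show "W n \<in> measurable (M n) (count_space UNIV)"
      unfolding W_def using P1[OF n] P2[OF n] by (intro measurable_num_isolated) (auto simp: poisson_process_def)
  next
    fix k
    show "(\<lambda>n. measure (M n) {\<omega> \<in> space (M n). W n \<omega> = k}) \<longlonglongrightarrow> pmf (poisson_pmf \<beta>) k"
      using lim[of k] beta by (simp add: pois_def)
  qed
  moreover have "(\<lambda>n. measure (M n) {\<omega> \<in> space (M n). largest_nn_radius (P1 n \<omega>) (P2 n \<omega>) \<le> ennreal (r n)}) \<longlonglongrightarrow> exp (- \<beta>)"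
  proof (rule Lim_transform_eventually)
    show "(\<lambda>n. measure (M n) {\<omega> \<in> space (M n). W n \<omega> = 0}) \<longlonglongrightarrow> exp (- \<beta>)"
      using lim[of 0] by (simp add: pois_def)
    have "{\<omega> \<in> space (M n). W n \<omega> = 0} = {\<omega> \<in> space (M n). largest_nn_radius (P1 n \<omega>) (P2 n \<omega>) \<le> ennreal (r n)}"
      if n: "n > 0" for n
    proof -
      interpret ab_graph "M n" "P1 n" "P2 n" "real n" "c * real n" by (rule graph[OF n])
      \<comment> \<open>\<open>powr\<close> is nonnegative even where the logarithm is not, so this
        needs no lower bound on \<open>n\<close>.\<close>
      have "r n \<ge> 0" by (simp add: r_def conn_radius_def)
      then show ?thesis
        using largest_nn_radius_le_iff[OF X.finite_P Y.finite_P] unfolding W_def by blast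
    qed
    then show "eventually (\<lambda>n. measure (M n) {\<omega> \<in> space (M n). W n \<omega> = 0} =
      measure (M n) {\<omega> \<in> space (M n). largest_nn_radius (P1 n \<omega>) (P2 n \<omega>) \<le> ennreal (r n)}) sequentially"
      by (intro eventually_mono[OF eventually_gt_at_top[of 0]]) simp
  qed
  ultimately show ?thesis unfolding W_def r_def by blast
qed

end
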